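(* Let $r\ge 1$, let $\mathbf{m}=(m_1,\ldots,m_r)$ be positive integers, $m=m_1+\cdots+m_r$, and let $\mathbf{f}=(f_1,\ldots,f_r)$ with $f_j\in\mathbb{C}\setminus\{0,-1,-2,\ldots\}$. For all (complex) values of the parameters $b,c,\mathbf{f}$ such that both sides make sense, the following product formula holds: $$ \left[\sum_{k=0}^{\infty}\frac{(b)_k(c)_k(\mathbf{f}+\mathbf{m})_k}{(1/2+c+b+m)_k(\mathbf{f})_k\,k!}x^k\right]^2 =\frac{(1/2)_{m}(c+b+1/2)_{m}}{(b+1/2)_{m}(c+1/2)_{m}}\sum_{k=0}^{\infty}\frac{(2b)_k(2c)_k(c+b)_k}{(1/2+c+b+m)_k(2c+2b)_k\,k!}R(k)\,x^k . $$ (The series on the left is ${}_{r+2}F_{r+1}(b,c,\mathbf{f}+\mathbf{m};1/2+c+b+m,\mathbf{f};x)$.) Here $$ R(k)=\frac{(\mathbf{f}+k)_{\mathbf{m}}\,(c+k/2)_{m}}{[(\mathbf{f})_{\mathbf{m}}]^2\,(c+b+k/2)_{m}}\,\hat{R}(-b) $$ is a rational function of $k$, where $\hat R(t)$ is the polynomial in $t$ (depending also on $k$, $b$, $c$, $\mathbf{f}$, $\mathbf{m}$) given by $$ \hat R=\hat T_m\big(c,\tfrac12-\tfrac k2;1-\tfrac k2\big)\,\hat T_m\big(\tfrac12-k-m-c-b,\;f_r+\tfrac k2-M_{r-1};\;1-\tfrac k2\big)\,G_r , $$ with $M_0=0$, $M_s=m_1+\cdots+m_s$ for $s=1,\ldots,r$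 (so $M_r=m$), $G_1(t)=(f_1+t)_{m_1}$ and, for $s=2,\ldots,r$, $$ G_s(t)=(f_s+t)_{m_s}\cdot\Big[\hat T_{M_{s-1}}\big(1-k-f_s,\;f_{s-1}+\tfrac k2-M_{s-2};\;1-\tfrac k2\big)G_{s-1}\Big](t), $$ and where $\hat R(-b)$ is the value of $\hat R(t)$ at $t=-b$. The operators $\hat T_N(\alpha,\beta;\gamma)$ are the second Miller-Paris operators.
   Context: Notation: $(a)_k=\Gamma(a+k)/\Gamma(a)=a(a+1)\cdots(a+k-1)$ is the Pochhammer symbol. For vectors, $(\mathbf{f})_k=\prod_j (f_j)_k$, $(\mathbf{f}+\mathbf{m})_k=\prod_j(f_j+m_j)_k$, $(\mathbf{f})_{\mathbf{m}}=\prod_j (f_j)_{m_j}$, $(\mathbf{f}+k)_{\mathbf{m}}=\prod_j(f_j+k)_{m_j}$. Second Miller-Paris operator: for an integer $N\ge 1$ and parameters $\alpha,\beta,\gamma$, $\hat T_N(\alpha,\beta;\gamma)$ is the linear operator which maps a polynomial $F$ of degree at most $N$ to the polynomial of degree at most $N$ in $t$ $$ [\hat T_N(\alpha,\beta;\gamma)F](t)=\sum_{i=0}^{N}\frac{(\alpha)_i(\beta)_i(-t)_i}{i!\,(\gamma-\alpha-N)_i(\gamma-\beta-N)_i}\left(\sum_{j=0}^{i}\frac{(-i)_j}{j!}F(j)\right)\sum_{l=0}^{N-i}\frac{(-N+i)_l(i-t)_l(\gamma-\alpha-\beta-N)_l}{(\gamma-\alpha-N+i)_l(\gamma-\beta-N+i)_l\,l!}.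 $$ A product of operators denotes composition, the rightmost operator acting first. The identity is between power series in $x$; "both sides make sense" means that no denominator occurring in the expressions vanishes. *)

theory Defs
  imports
    "HOL-Computational_Algebra.Polynomial"
    "HOL-Computational_Algebra.Formal_Power_Series"
    "HOL-Library.Nonpos_Ints"
begin

text \<open>
  Vectors such as \<open>(f\<^sub>1, \<dots>, f\<^sub>r)\<close> are functions on \<^typ>\<open>nat\<close> of which only the values at
  \<open>1, \<dots>, r\<close> are used. Pochhammer symbols whose argument is a linear function of the polynomial
  variable \<open>t\<close> are taken in the polynomial ring: \<open>(-t)\<^sub>i\<close> is \<open>pochhammer [:0, -1:] i\<close>,
  \<open>(i - t)\<^sub>l\<close> is \<open>pochhammer [:of_nat i, -1:] l\<close>, and \<open>(a + t)\<^sub>n\<close> is \<open>pochhammer [:a, 1:] n\<close>.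
\<close>

text \<open>
  The formula makes sense for every polynomial \<open>F\<close>; the operator is only meant to be applied to
  polynomials of degree at most \<open>N\<close>.
\<close>

definition miller_paris2 ::
  "nat \<Rightarrow> complex \<Rightarrow> complex \<Rightarrow> complex \<Rightarrow> complex poly \<Rightarrow> complex poly" where
  "miller_paris2 N \<alpha> \<beta> \<gamma> F =
     (\<Sum>i=0..N.
        smult (pochhammer \<alpha> i * pochhammer \<beta> i /
               (fact i * pochhammer (\<gamma> - \<alpha> - of_nat N) i * pochhammer (\<gamma> - \<beta> - of_nat N) i) *
               (\<Sum>j=0..i. pochhammer (- of_nat i) j / fact j * poly F (of_nat j)))
          (pochhammer [:0, -1:] i *
           (\<Sum>l=0..N - i.
              smult (pochhammer (- of_nat N + of_nat i) l * pochhammer (\<gamma> - \<alpha> - \<beta> - of_nat N) l /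
                     (pochhammer (\<gamma> - \<alpha> - of_nat N + of_nat i) l *
                      pochhammer (\<gamma> - \<beta> - of_nat N + of_nat i) l * fact l))
                (pochhammer [:of_nat i, -1:] l))))"

definition miller_paris2_defined :: "nat \<Rightarrow> complex \<Rightarrow> complex \<Rightarrow> complex \<Rightarrow> bool" where
  "miller_paris2_defined N \<alpha> \<beta> \<gamma> \<longleftrightarrow>
     (\<forall>i\<le>N. pochhammer (\<gamma> - \<alpha> - of_nat N) i \<noteq> 0 \<and> pochhammer (\<gamma> - \<beta> - of_nat N) i \<noteq> 0 \<and>
        (\<forall>l\<le>N - i. pochhammer (\<gamma> - \<alpha> - of_nat N + of_nat i) l \<noteq> 0 \<and>
                    pochhammer (\<gamma> - \<beta> - of_nat N + of_nat i) l \<noteq> 0))"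

definition partial_sum :: "(nat \<Rightarrow> nat) \<Rightarrow> nat \<Rightarrow> nat" where
  "partial_sum m s = (\<Sum>j=1..s. m j)"

text \<open>
  The polynomials \<open>G\<^sub>s\<close> are indexed from \<open>s = 1\<close>; the value at \<open>s = 0\<close> is arbitrary and never used.
  The variable \<open>k\<close> is complex because \<open>R\<close> is asserted to be a rational function of it.
\<close>

fun G_poly :: "(nat \<Rightarrow> complex) \<Rightarrow> (nat \<Rightarrow> nat) \<Rightarrow> complex \<Rightarrow> nat \<Rightarrow> complex poly" where
  "G_poly f m k 0 = 1"
| "G_poly f m k (Suc 0) = pochhammer [:f 1, 1:] (m 1)"
| "G_poly f m k (Suc (Suc n)) =
     (let s = Suc (Suc n) in
      pochhammer [:f s, 1:] (m s) *
      miller_paris2 (partial_sum m (s - 1)) (1 - k - f s)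
        (f (s - 1) + k / 2 - of_nat (partial_sum m (s - 2))) (1 - k / 2)
        (G_poly f m k (Suc n)))"

definition R_hat ::
  "complex \<Rightarrow> complex \<Rightarrow> nat \<Rightarrow> (nat \<Rightarrow> complex) \<Rightarrow> (nat \<Rightarrow> nat) \<Rightarrow> complex \<Rightarrow> complex poly" where
  "R_hat b c r f m k =
     (let M = partial_sum m r in
      miller_paris2 M c (1 / 2 - k / 2) (1 - k / 2)
        (miller_paris2 M (1 / 2 - k - of_nat M - c - b)
           (f r + k / 2 - of_nat (partial_sum m (r - 1))) (1 - k / 2)
           (G_poly f m k r)))"

definition R_fun ::
  "complex \<Rightarrow> complex \<Rightarrow> nat \<Rightarrow> (nat \<Rightarrow> complex) \<Rightarrow> (nat \<Rightarrow> nat) \<Rightarrow> complex \<Rightarrow> complex" where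
  "R_fun b c r f m k =
     (\<Prod>j=1..r. pochhammer (f j + k) (m j)) * pochhammer (c + k / 2) (partial_sum m r) /
     ((\<Prod>j=1..r. pochhammer (f j) (m j))\<^sup>2 * pochhammer (c + b + k / 2) (partial_sum m r)) *
     poly (R_hat b c r f m k) (- b)"

text \<open>
  No denominator in the expression for \<open>R(k)\<close>, including those in the operators that build up
  \<open>G\<^sub>2, \<dots>, G\<^sub>r\<close>, vanishes.
\<close>

definition R_defined ::
  "complex \<Rightarrow> complex \<Rightarrow> nat \<Rightarrow> (nat \<Rightarrow> complex) \<Rightarrow> (nat \<Rightarrow> nat) \<Rightarrow> complex \<Rightarrow> bool" where
  "R_defined b c r f m k \<longleftrightarrow>
     (let M = partial_sum m r in
      (\<Prod>j=1..r. pochhammer (f j) (m j)) \<noteq> 0 \<and>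
      pochhammer (c + b + k / 2) M \<noteq> 0 \<and>
      miller_paris2_defined M c (1 / 2 - k / 2) (1 - k / 2) \<and>
      miller_paris2_defined M (1 / 2 - k - of_nat M - c - b)
        (f r + k / 2 - of_nat (partial_sum m (r - 1))) (1 - k / 2) \<and>
      (\<forall>s\<in>{2..r}. miller_paris2_defined (partial_sum m (s - 1)) (1 - k - f s)
        (f (s - 1) + k / 2 - of_nat (partial_sum m (s - 2))) (1 - k / 2)))"

definition lhs_series ::
  "complex \<Rightarrow> complex \<Rightarrow> nat \<Rightarrow> (nat \<Rightarrow> complex) \<Rightarrow> (nat \<Rightarrow> nat) \<Rightarrow> complex fps" where
  "lhs_series b c r f m = Abs_fps (\<lambda>k.
     pochhammer b k * pochhammer c k * (\<Prod>j=1..r. pochhammer (f j + of_nat (m j)) k) /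
     (pochhammer (1 / 2 + c + b + of_nat (partial_sum m r)) k *
      (\<Prod>j=1..r. pochhammer (f j) k) * fact k))"

definition rhs_series ::
  "complex \<Rightarrow> complex \<Rightarrow> nat \<Rightarrow> (nat \<Rightarrow> complex) \<Rightarrow> (nat \<Rightarrow> nat) \<Rightarrow> complex fps" where
  "rhs_series b c r f m = Abs_fps (\<lambda>k.
     pochhammer (2 * b) k * pochhammer (2 * c) k * pochhammer (c + b) k /
     (pochhammer (1 / 2 + c + b + of_nat (partial_sum m r)) k *
      pochhammer (2 * c + 2 * b) k * fact k) * R_fun b c r f m (of_nat k))"

definition rhs_prefactor :: "complex \<Rightarrow> complex \<Rightarrow> nat \<Rightarrow> complex" where
  "rhs_prefactor b c M =
     pochhammer (1 / 2) M * pochhammer (c + b + 1 / 2) M /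
     (pochhammer (b + 1 / 2) M * pochhammer (c + 1 / 2) M)"

text \<open>Both sides of the product formula make sense: no denominator occurring in them vanishes.\<close>

definition both_sides_defined ::
  "complex \<Rightarrow> complex \<Rightarrow> nat \<Rightarrow> (nat \<Rightarrow> complex) \<Rightarrow> (nat \<Rightarrow> nat) \<Rightarrow> bool" where
  "both_sides_defined b c r f m \<longleftrightarrow>
     pochhammer (b + 1 / 2) (partial_sum m r) \<noteq> 0 \<and>
     pochhammer (c + 1 / 2) (partial_sum m r) \<noteq> 0 \<and>
     (\<forall>k::nat. pochhammer (1 / 2 + c + b + of_nat (partial_sum m r)) k \<noteq> 0 \<and>
        (\<Prod>j=1..r. pochhammer (f j) k) \<noteq> 0 \<and>
        pochhammer (2 * c + 2 * b) k \<noteq> 0 \<and>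
        R_defined b c r f m (of_nat k))"

end

theory Submission
  imports Defs
begin

text \<open>
  Multiplying out the square, the coefficient of $x^k$ is, with $a = -k$ and $d = 1/2 + c + b + m$, a well-poised sum
  $\sum_j (a)_j (b)_j (c)_j (1+a-d)_j / (j!\, (1+a-b)_j (1+a-c)_j (d)_j) \cdot Q(j)$
  in which the polynomial $Q(j) \sim \prod_t (f_t+j)_{m_t} (f_t-a-j)_{m_t}$ is symmetric under $j \mapsto -a-j$.
  The polynomials $G_s$ are the coefficients of such products in the basis $(-j)_n (a+j)_n$:
  for a parameter $p$,
  \[ \frac{(p)_j (a/2)_j}{(1+a-p)_j (1+a/2)_j}\, Q(j) =
     \sum_n \frac{(1+a/2-p-M)_n}{(1+a-p)_n (1+a/2)_n\, n!}\, (-j)_n (a+j)_n\, G(n). \]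
  By the Pfaff-Saalschuetz formula a Miller-Paris operator replaces $p$ by another parameter, and multiplying $G$ by
  $(f+t)_{m_s}$ adjoins one more factor to $Q$. Ending with $p = 1+a-d$ and inserting the expansion,
  the sum over $j$ becomes a very-well-poised ${}_5F_4$, and the remaining sum over $n$ is evaluated
  at $t = -b$ by the last Miller-Paris operator.

  At $a = -k$ with $k$ even this computation meets vanishing denominators. It is therefore carried out for generic
  complex $a$ and $b = -v$ with $v \ge k$ a natural number, so that $b$ terminates all sums. Both sides being rational,
  the identity extends first from generic $a$ to $a = -k$ and then from $b = -v$ to all $b$.
\<close>

section \<open>Terminating hypergeometric summation formulas\<close>

text \<open>The quotient (a/2)_j / (1+a/2)_j in the expansion equals a/(a+2j). Moved to the other
  side it supplies the factor a+2j that makes the well-poised sum very-well-poised, where Bailey's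
  closed form is available. The final parameter 1+a-d is the upper partner of d, so the expansion
  absorbs this pair completely and leaves only b and c beside the basis. The basis fits because
  multiplication by (-j)_n (a+j)_n maps a very-well-poised term to one of the same kind with a+2n in
  place of a.

  The relation d = 1/2 + b + c + m decides the sum over n: with it, the symbols from the expansion
  and from Bailey's sum merge, and what is left is the coefficient law of the operator with
  parameters c, 1/2 + a/2; 1 + a/2 at the integer v. The constants are those of Clausen's formula
  for the square of a 2F1, corrected by symbols of length m.\<close>

lemma sum_nested_triangle:
  fixes g :: "nat \<Rightarrow> nat \<Rightarrow> 'a::comm_monoid_add"
  shows "(\<Sum>h\<le>n. \<Sum>l\<le>n - h. g h l) = (\<Sum>s\<le>n. \<Sum>h\<le>s. g h (s - h))"
proof -
  have "(\<Sum>h\<le>n. \<Sum>l\<le>n - h. g h l) = (\<Sum>(h,l)\<in>Sigma {..n} (\<lambda>h. {..n-h}). g h l)"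
    by (rule sum.Sigma) auto
  also have "Sigma {..n} (\<lambda>h. {..n-h}) = {(h,l). h + l \<le> n}"
    by auto
  finally show ?thesis
    by (simp add: sum.triangle_reindex_eq)
qed

lemma sum_nested_triangle_swap:
  fixes g :: "nat \<Rightarrow> nat \<Rightarrow> 'a::comm_monoid_add"
  shows "(\<Sum>v\<le>j. \<Sum>n\<le>v. g v n) = (\<Sum>n\<le>j. \<Sum>i\<le>j - n. g (n + i) n)"
  by (subst sum_nested_triangle) (intro sum.cong refl, simp)

lemma sum_triangle_comm:
  fixes g :: "nat \<Rightarrow> nat \<Rightarrow> 'a::comm_monoid_add"
  shows "(\<Sum>l\<le>n. \<Sum>h\<le>n - l. g l h) = (\<Sum>h\<le>n. \<Sum>l\<le>n - h. g l h)"
proof -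
  have "(\<Sum>l\<le>n. \<Sum>h\<le>n - l. g l h) = (\<Sum>(l,h)\<in>{(l,h). l + h \<le> n}. g l h)"
    by (subst sum.Sigma) (auto intro!: sum.cong)
  also have "\<dots> = (\<Sum>(h,l)\<in>{(h,l). h + l \<le> n}. g l h)"
    by (rule sum.reindex_bij_witness[of _ prod.swap prod.swap]) auto
  also have "\<dots> = (\<Sum>h\<le>n. \<Sum>l\<le>n - h. g l h)"
    by (subst sum.Sigma) (auto intro!: sum.cong)
  finally show ?thesis .
qed

lemma choose_mult_of_nat:
  assumes "h + l \<le> n"
  shows "of_nat (n choose h) * of_nat ((n - h) choose l) =
         (of_nat (n choose (h + l)) * of_nat ((h + l) choose h) :: 'a::comm_semiring_1)"
proof -
  have "(n choose h) * ((n - h) choose l) = (n choose (h + l)) * ((h + l) choose h)"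
    using choose_mult[of h "h + l" n] assms by simp
  then show ?thesis
    by (metis of_nat_mult)
qed

lemma choose_mult_comm_of_nat:
  assumes "h + l \<le> n"
  shows "of_nat (n choose h) * of_nat ((n - h) choose l) =
         (of_nat (n choose l) * of_nat ((n - l) choose h) :: 'a::comm_semiring_1)"
proof -
  have "h + l choose h = h + l choose l"
    using binomial_symmetric[of h "h + l"] by simp
  then show ?thesis
    using choose_mult_of_nat[OF assms, where 'a='a] choose_mult_of_nat[of l h n, where 'a='a] assms
    by (simp only: add.commute[of l h])
qed

lemma minus_one_power_diff:
  assumes "i \<le> n"
  shows "(-1) ^ i = (-1) ^ n * ((-1) ^ (n - i) :: 'a::comm_ring_1)"
proof -
  obtain d where "n = i + d" using assms le_Suc_ex by blast
  then show ?thesis by (simp add: power_add mult.assoc)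
qed

lemma pochhammer_reflect:
  fixes z :: "'a::comm_ring_1"
  shows "pochhammer (1 - z - of_nat n) n = (-1) ^ n * pochhammer z n"
  using pochhammer_minus[of "z + of_nat n - 1" n] by (simp add: algebra_simps)

lemma pochhammer_shift_swap:
  fixes z :: "'a::comm_semiring_1"
  shows "pochhammer z m * pochhammer (z + of_nat m) n = pochhammer z n * pochhammer (z + of_nat n) m"
  using pochhammer_product'[of z m n] pochhammer_product'[of z n m] by (simp add: add.commute)

text \<open>Three Vandermonde convolutions: writing \<open>D + h\<close> as
  \<open>(A + h) + (D - A)\<close> merges the factors with \<open>A\<close> into one symbol of
  length \<open>h + l\<close>; the sum over \<open>h\<close> at fixed \<open>h + l\<close> and then
  the outer sum are convolutions again. Both lower Pochhammer symbols of the Pfaff-Saalschuetz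
  formula are multiplied out, so the identity holds also where the classical denominators
  vanish.\<close>

lemma saalschuetz:
  fixes A B D :: "'a::comm_ring_1"
  shows "(\<Sum>h\<le>n. of_nat (n choose h) * pochhammer A h * pochhammer B h *
            pochhammer (D + of_nat h) (n - h) * pochhammer (D - A - B) (n - h)) =
         pochhammer (D - A) n * pochhammer (D - B) n"
proof -
  define s where "s = D - A - B"
  have *: "pochhammer (D + of_nat h) (n - h) =
     (\<Sum>l\<le>n - h. of_nat ((n - h) choose l) * pochhammer (A + of_nat h) l * pochhammer (D - A) (n - h - l))" for h
    using pochhammer_binomial_sum[of "A + of_nat h" "D - A" "n - h"] by (simp add: add.commute)
  have "(\<Sum>h\<le>n. of_nat (n choose h) * pochhammer A h * pochhammer B h *
            pochhammer (D + of_nat h) (n - h) * pochhammer s (n - h)) =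
     (\<Sum>h\<le>n. \<Sum>l\<le>n - h. of_nat (n choose h) * of_nat ((n - h) choose l) * pochhammer A (h + l) *
        pochhammer B h * pochhammer (D - A) (n - h - l) * pochhammer s (n - h))"
    unfolding * by (simp add: sum_distrib_left sum_distrib_right pochhammer_product' mult_ac)
  also have "\<dots> = (\<Sum>t\<le>n. \<Sum>h\<le>t. of_nat (n choose h) * of_nat ((n - h) choose (t - h)) * pochhammer A t *
        pochhammer B h * pochhammer (D - A) (n - t) * pochhammer s (n - h))"
    unfolding sum_nested_triangle by (intro sum.cong refl) simp
  also have "\<dots> = (\<Sum>t\<le>n. \<Sum>h\<le>t. of_nat (n choose t) * pochhammer A t * pochhammer (D - A) (n - t) * pochhammer s (n - t) *
        (of_nat (t choose h) * pochhammer B h * pochhammer (s + of_nat (n - t)) (t - h)))"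
  proof (intro sum.cong refl)
    fix t h assume "t \<in> {..n}" "h \<in> {..t}"
    then have "h \<le> t" "t \<le> n" by auto
    then have "pochhammer s (n - h) = pochhammer s (n - t) * pochhammer (s + of_nat (n - t)) (t - h)"
      using pochhammer_product'[of s "n - t" "t - h"] by simp
    then show "of_nat (n choose h) * of_nat ((n - h) choose (t - h)) * pochhammer A t *
        pochhammer B h * pochhammer (D - A) (n - t) * pochhammer s (n - h) =
      of_nat (n choose t) * pochhammer A t * pochhammer (D - A) (n - t) * pochhammer s (n - t) *
        (of_nat (t choose h) * pochhammer B h * pochhammer (s + of_nat (n - t)) (t - h))"
      using choose_mult_of_nat[of h "t - h" n, where 'a='a] \<open>h \<le> t\<close> \<open>t \<le> n\<close>
      by (simp add: mult_ac)
  qed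
  also have "\<dots> = (\<Sum>t\<le>n. pochhammer (D - A) n * (of_nat (n choose t) * pochhammer A t * pochhammer s (n - t)))"
  proof (intro sum.cong refl)
    fix t assume "t \<in> {..n}"
    then have "t \<le> n" by simp
    have "(\<Sum>h\<le>t. of_nat (t choose h) * pochhammer B h * pochhammer (s + of_nat (n - t)) (t - h)) =
          pochhammer (B + (s + of_nat (n - t))) t"
      by (rule pochhammer_binomial_sum[symmetric])
    also have "B + (s + of_nat (n - t)) = D - A + of_nat (n - t)"
      by (simp add: s_def)
    finally have "(\<Sum>h\<le>t. of_nat (t choose h) * pochhammer B h * pochhammer (s + of_nat (n - t)) (t - h)) =
          pochhammer (D - A + of_nat (n - t)) t" .
    moreover have "pochhammer (D - A) n = pochhammer (D - A) (n - t) * pochhammer (D - A + of_nat (n - t)) t"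
      using pochhammer_product'[of "D - A" "n - t" t] \<open>t \<le> n\<close> by simp
    ultimately show "(\<Sum>h\<le>t. of_nat (n choose t) * pochhammer A t * pochhammer (D - A) (n - t) * pochhammer s (n - t) *
        (of_nat (t choose h) * pochhammer B h * pochhammer (s + of_nat (n - t)) (t - h))) =
        pochhammer (D - A) n * (of_nat (n choose t) * pochhammer A t * pochhammer s (n - t))"
      unfolding sum_distrib_left[symmetric] by (simp only: mult_ac)
  qed
  also have "\<dots> = pochhammer (D - A) n * pochhammer (D - B) n"
    by (simp add: sum_distrib_left[symmetric] pochhammer_binomial_sum[symmetric] s_def)
  finally show ?thesis
    by (simp add: s_def)
qed

text \<open>The hypothesis is the balancing condition; by reflection it turns the symbol of
  \<open>X - A - B\<close> into one of \<open>Y + i\<close>, so that the two lower parameters appear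
  alike. Well-poised expansions lead to the sum in this shape.\<close>

lemma saalschuetz':
  fixes A B X Y :: "'a::comm_ring_1"
  assumes "X + Y = A + B - of_nat n + 1"
  shows "(\<Sum>i\<le>n. of_nat (n choose i) * (-1) ^ i * pochhammer A i * pochhammer B i *
            pochhammer (X + of_nat i) (n - i) * pochhammer (Y + of_nat i) (n - i)) =
         (-1) ^ n * pochhammer (X - A) n * pochhammer (X - B) n"
proof -
  have *: "(-1) ^ i * (z * pochhammer (Y + of_nat i) (n - i)) = (-1) ^ n * (z * pochhammer (X - A - B) (n - i))"
    if "i \<le> n" for i z
  proof -
    have Y: "Y = A + B - of_nat n + 1 - X" using assms by (simp add: algebra_simps)
    have *: "X - A - B = 1 - (Y + of_nat i) - of_nat (n - i)"
      using that unfolding Y by (simp add: of_nat_diff)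
    have "(-1) ^ i = (-1) ^ n * ((-1) ^ (n - i) :: 'a)"
      using that by (rule minus_one_power_diff)
    then show ?thesis
      unfolding * pochhammer_reflect by (simp add: mult.left_commute)
  qed
  have "(\<Sum>i\<le>n. of_nat (n choose i) * (-1) ^ i * pochhammer A i * pochhammer B i *
            pochhammer (X + of_nat i) (n - i) * pochhammer (Y + of_nat i) (n - i)) =
     (\<Sum>i\<le>n. (-1) ^ n * (of_nat (n choose i) * pochhammer A i * pochhammer B i *
            pochhammer (X + of_nat i) (n - i) * pochhammer (X - A - B) (n - i)))"
    proof (intro sum.cong refl)
    fix i assume "i \<in> {..n}"
    then show "of_nat (n choose i) * (-1) ^ i * pochhammer A i * pochhammer B i *
            pochhammer (X + of_nat i) (n - i) * pochhammer (Y + of_nat i) (n - i) =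
         (-1) ^ n * (of_nat (n choose i) * pochhammer A i * pochhammer B i *
            pochhammer (X + of_nat i) (n - i) * pochhammer (X - A - B) (n - i))"
      using *[of i "of_nat (n choose i) * pochhammer A i * pochhammer B i * pochhammer (X + of_nat i) (n - i)"]
      by (simp add: mult_ac)
  qed
  then show ?thesis
    unfolding sum_distrib_left[symmetric] saalschuetz by (simp only: mult.assoc)
qed

lemma vandermonde_diff:
  fixes x y :: "'a::comm_ring_1"
  shows "(\<Sum>l\<le>n. of_nat (n choose l) * (-1) ^ l * pochhammer x l * pochhammer (y + of_nat l) (n - l)) =
         pochhammer (y - x) n"
proof -
  have "(-1) ^ l * pochhammer (y + of_nat l) (n - l) = (-1) ^ n * pochhammer (1 - y - of_nat n) (n - l)"
    if "l \<le> n" for l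
  proof -
    have *: "1 - y - of_nat n = 1 - (y + of_nat l) - of_nat (n - l)"
      using that by (simp add: of_nat_diff)
    have "(-1) ^ l = (-1) ^ n * ((-1) ^ (n - l) :: 'a)"
      using that by (rule minus_one_power_diff)
    then show ?thesis
      unfolding * pochhammer_reflect by simp
  qed
  then have "(\<Sum>l\<le>n. of_nat (n choose l) * (-1) ^ l * pochhammer x l * pochhammer (y + of_nat l) (n - l)) =
     (\<Sum>l\<le>n. (-1) ^ n * (of_nat (n choose l) * pochhammer x l * pochhammer (1 - y - of_nat n) (n - l)))"
    by (intro sum.cong refl) (simp add: mult_ac)
  also have "\<dots> = (-1) ^ n * pochhammer (x + (1 - y - of_nat n)) n"
    by (simp add: sum_distrib_left[symmetric] pochhammer_binomial_sum)
  also have "x + (1 - y - of_nat n) = 1 - (y - x) - of_nat n" by simp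
  finally show ?thesis
    unfolding pochhammer_reflect by simp
qed

text \<open>A terminating 3F2 transformation in which \<open>K\<close> measures how far the left sum
  is from being balanced; for \<open>K = 0\<close> only \<open>l = 0\<close> survives on the right.
  Each product on the right is opened by \<open>saalschuetz\<close> with \<open>C - K + l\<close>,
  after which a Vandermonde sum over \<open>l\<close> restores \<open>C\<close>. For natural
  \<open>K\<close> the right side stops at \<open>l = K\<close>, like the inner sum over
  \<open>l\<close> in the operator.\<close>

lemma saalschuetz_extended:
  fixes A B C K s :: "'a::comm_ring_1"
  assumes s: "s = C - A - B - K"
  shows "(\<Sum>h\<le>n. of_nat (n choose h) * pochhammer A h * pochhammer B h *
            pochhammer (C + of_nat h) (n - h) * pochhammer s (n - h)) =
         (\<Sum>l\<le>n. of_nat (n choose l) * (-1) ^ l * pochhammer (- K) l * pochhammer s l *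
            pochhammer (C - A - K + of_nat l) (n - l) * pochhammer (C - B - K + of_nat l) (n - l))"
proof -
  define D where "D = C - K"
  have "(\<Sum>l\<le>n. of_nat (n choose l) * (-1) ^ l * pochhammer (- K) l * pochhammer s l *
            pochhammer (C - A - K + of_nat l) (n - l) * pochhammer (C - B - K + of_nat l) (n - l)) =
     (\<Sum>l\<le>n. \<Sum>h\<le>n - l. of_nat (n choose l) * of_nat ((n - l) choose h) * (-1) ^ l * pochhammer (- K) l *
        pochhammer A h * pochhammer B h * pochhammer (D + of_nat h + of_nat l) (n - h - l) * pochhammer s (n - h))"
  proof (intro sum.cong refl)
    fix l assume "l \<in> {..n}"
    then have "l \<le> n" by simp
    have "pochhammer (C - A - K + of_nat l) (n - l) * pochhammer (C - B - K + of_nat l) (n - l) =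
      (\<Sum>h\<le>n - l. of_nat ((n - l) choose h) * pochhammer A h * pochhammer B h *
            pochhammer (D + of_nat l + of_nat h) (n - l - h) * pochhammer (D + of_nat l - A - B) (n - l - h))"
      by (subst saalschuetz) (simp add: D_def algebra_simps)
    moreover have "D + of_nat l - A - B = s + of_nat l" by (simp add: D_def s algebra_simps)
    moreover have "pochhammer s (n - h) = pochhammer s l * pochhammer (s + of_nat l) (n - l - h)"
      if "h \<le> n - l" for h
    proof -
      have "n - h = l + (n - l - h)" using that \<open>l \<le> n\<close> by linarith
      then show ?thesis
        using pochhammer_product'[of s l "n - l - h"] by simp
    qed
    ultimately show "of_nat (n choose l) * (-1) ^ l * pochhammer (- K) l * pochhammer s l *
            pochhammer (C - A - K + of_nat l) (n - l) * pochhammer (C - B - K + of_nat l) (n - l) =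
      (\<Sum>h\<le>n - l. of_nat (n choose l) * of_nat ((n - l) choose h) * (-1) ^ l * pochhammer (- K) l *
        pochhammer A h * pochhammer B h * pochhammer (D + of_nat h + of_nat l) (n - h - l) * pochhammer s (n - h))"
      by (simp add: sum_distrib_left mult.assoc)
        (intro sum.cong refl, simp add: mult_ac add_ac diff_commute)
  qed
  also have "\<dots> = (\<Sum>h\<le>n. \<Sum>l\<le>n - h. of_nat (n choose l) * of_nat ((n - l) choose h) * (-1) ^ l * pochhammer (- K) l *
        pochhammer A h * pochhammer B h * pochhammer (D + of_nat h + of_nat l) (n - h - l) * pochhammer s (n - h))"
    by (rule sum_triangle_comm)
  also have "\<dots> = (\<Sum>h\<le>n. of_nat (n choose h) * pochhammer A h * pochhammer B h *
            pochhammer (C + of_nat h) (n - h) * pochhammer s (n - h))"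
  proof (intro sum.cong refl)
    fix h assume "h \<in> {..n}"
    have "(\<Sum>l\<le>n - h. of_nat (n choose l) * of_nat ((n - l) choose h) * (-1) ^ l * pochhammer (- K) l *
        pochhammer A h * pochhammer B h * pochhammer (D + of_nat h + of_nat l) (n - h - l) * pochhammer s (n - h)) =
      (\<Sum>l\<le>n - h. of_nat (n choose h) * pochhammer A h * pochhammer B h * pochhammer s (n - h) *
        (of_nat ((n - h) choose l) * (-1) ^ l * pochhammer (- K) l * pochhammer (D + of_nat h + of_nat l) (n - h - l)))"
    proof (intro sum.cong refl, goal_cases)
      case (1 l)
      then have "l + h \<le> n" using \<open>h \<in> {..n}\<close> by auto
      then show ?case
        by (subst choose_mult_comm_of_nat) (simp_all only: mult_ac)
    qed
    also have "\<dots> = of_nat (n choose h) * pochhammer A h * pochhammer B h * pochhammer s (n - h) *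
        pochhammer (D + of_nat h + K) (n - h)"
      unfolding sum_distrib_left[symmetric] vandermonde_diff by simp
    finally show "(\<Sum>l\<le>n - h. of_nat (n choose l) * of_nat ((n - l) choose h) * (-1) ^ l * pochhammer (- K) l *
        pochhammer A h * pochhammer B h * pochhammer (D + of_nat h + of_nat l) (n - h - l) * pochhammer s (n - h)) =
      of_nat (n choose h) * pochhammer A h * pochhammer B h *
            pochhammer (C + of_nat h) (n - h) * pochhammer s (n - h)"
      by (simp add: D_def mult_ac)
  qed
  finally show ?thesis by simp
qed

section \<open>The second Miller-Paris operator\<close>

lemma pochhammer_minus_of_nat:
  "pochhammer (- of_nat n :: 'a::field_char_0) i = (-1) ^ i * fact i * of_nat (n choose i)"
proof -
  have "(of_nat (n choose i) :: 'a) = (-1) ^ i * pochhammer (- of_nat n) i / fact i"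
    by (simp add: binomial_gbinomial gbinomial_pochhammer)
  then have "fact i * of_nat (n choose i) = (-1) ^ i * pochhammer (- of_nat n :: 'a) i"
    by (simp add: field_simps)
  then show ?thesis
    by (simp add: mult.assoc)
qed

lemma binomial_inversion:
  fixes F :: "nat \<Rightarrow> 'a::comm_ring_1"
  shows "(\<Sum>i\<le>n. (-1) ^ i * of_nat (n choose i) * (\<Sum>j\<le>i. (-1) ^ j * of_nat (i choose j) * F j)) = F n"
proof -
  have "(\<Sum>i\<le>n. (-1) ^ i * of_nat (n choose i) * (\<Sum>j\<le>i. (-1) ^ j * of_nat (i choose j) * F j)) =
    (\<Sum>i\<le>n. \<Sum>j\<le>i. (-1) ^ i * of_nat (n choose i) * ((-1) ^ j * of_nat (i choose j) * F j))"
    by (simp add: sum_distrib_left)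
  also have "\<dots> = (\<Sum>j\<le>n. \<Sum>h\<le>n - j. (-1) ^ (j + h) * of_nat (n choose (j + h)) * ((-1) ^ j * of_nat ((j + h) choose j) * F j))"
    by (rule sum_nested_triangle_swap)
  also have "\<dots> = (\<Sum>j\<le>n. of_nat (n choose j) * F j * (\<Sum>h\<le>n - j. (-1) ^ h * of_nat ((n - j) choose h)))"
  proof (unfold sum_distrib_left, intro sum.cong refl, goal_cases)
    case (1 j h)
    then have le: "j + h \<le> n" by auto
    have "(-1) ^ (j + h) * of_nat (n choose (j + h)) * ((-1) ^ j * of_nat ((j + h) choose j) * F j) =
          (of_nat (n choose (j + h)) * of_nat ((j + h) choose j)) * ((-1) ^ h * F j)"
      by (simp add: power_add mult_ac)
    then show ?case
      unfolding choose_mult_of_nat[OF le, symmetric] by (simp only: mult_ac)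
  qed
  also have "\<dots> = (\<Sum>j\<in>{n}. of_nat (n choose j) * F j * (\<Sum>h\<le>n - j. (-1) ^ h * of_nat ((n - j) choose h)))"
    by (rule sum.mono_neutral_right) (auto simp: choose_alternating_sum)
  finally show ?thesis by simp
qed

lemma poly_pochhammer: "poly (pochhammer p n) x = pochhammer (poly p x) n"
  by (induction n) (simp_all add: pochhammer_Suc)

lemma degree_pochhammer_linear: "degree (pochhammer [:a, b:] n :: 'a::{comm_ring_1,semiring_no_zero_divisors} poly) \<le> n"
proof (induction n)
  case (Suc n)
  have "degree (pochhammer [:a, b:] n * ([:a, b:] + of_nat n)) \<le> n + 1"
    by (rule order_trans[OF degree_mult_le add_mono[OF Suc]]) (simp add: of_nat_poly)
  then show ?case by (simp add: pochhammer_Suc)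
qed simp

text \<open>The inner sum is (-1)^i times the i-th forward difference of \<open>F\<close> at 0, and
  these differences are all that the operator uses of \<open>F\<close>. Both sides have degree at
  most \<open>N\<close> and agree at 0, ..., N by binomial inversion.\<close>

lemma newton_expansion:
  fixes F :: "'a::field_char_0 poly"
  assumes "degree F \<le> N"
  shows "poly F x = (\<Sum>i\<le>N. (\<Sum>j\<le>i. pochhammer (- of_nat i) j / fact j * poly F (of_nat j)) *
                       (pochhammer (- x) i / fact i))"
proof -
  define \<phi> where "\<phi> i = (\<Sum>j\<le>i. pochhammer (- of_nat i) j / fact j * poly F (of_nat j))" for i
  define P where "P = (\<Sum>i\<le>N. smult (\<phi> i / fact i) (pochhammer [:0, -1:] i))"
  have P: "poly P x = (\<Sum>i\<le>N. \<phi> i * (pochhammer (- x) i / fact i))" for x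
    by (simp add: P_def poly_sum poly_pochhammer)
  have "F = P"
  proof (rule poly_eqI_degree[of "of_nat ` {..N}"])
    fix x :: 'a assume "x \<in> of_nat ` {..N}"
    then obtain n where n: "n \<le> N" "x = of_nat n" by auto
    have "poly P x = (\<Sum>i\<le>N. \<phi> i * ((-1) ^ i * of_nat (n choose i)))"
      by (simp add: P n pochhammer_minus_of_nat)
    also have "\<dots> = (\<Sum>i\<le>n. \<phi> i * ((-1) ^ i * of_nat (n choose i)))"
      using n by (intro sum.mono_neutral_right) auto
    also have "\<dots> = (\<Sum>i\<le>n. (-1) ^ i * of_nat (n choose i) * (\<Sum>j\<le>i. (-1) ^ j * of_nat (i choose j) * poly F (of_nat j)))"
      by (simp add: \<phi>_def pochhammer_minus_of_nat mult_ac)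
    also have "\<dots> = poly F x"
      by (simp add: binomial_inversion n)
    finally show "poly F x = poly P x" ..
  next
    have "card (of_nat ` {..N} :: 'a set) = Suc N"
      by (subst card_image) (auto simp: inj_on_def)
    moreover have "degree P \<le> N"
      unfolding P_def
      by (rule degree_sum_le) (auto intro!: order_trans[OF degree_smult_le] order_trans[OF degree_pochhammer_linear])
    ultimately show "degree P < card (of_nat ` {..N} :: 'a set)" "degree F < card (of_nat ` {..N} :: 'a set)"
      using assms by auto
  qed
  then show ?thesis
    using P[of x] by (simp add: \<phi>_def)
qed

lemma degree_miller_paris2: "degree (miller_paris2 N \<alpha> \<beta> \<gamma> F) \<le> N"
  unfolding miller_paris2_def
proof (rule degree_sum_le, simp, rule order_trans[OF degree_smult_le])
  fix i assume i: "i \<in> {0..N}"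
  have "degree (\<Sum>l = 0..N - i. smult (c l) (pochhammer [:of_nat i, - 1 :: complex:] l)) \<le> N - i" for c
    by (rule degree_sum_le) (auto intro!: order_trans[OF degree_smult_le] order_trans[OF degree_pochhammer_linear])
  then have "degree (pochhammer [:0, - 1 :: complex:] i * (\<Sum>l = 0..N - i. smult (c l) (pochhammer [:of_nat i, - 1:] l))) \<le> i + (N - i)" for c
    by (rule order_trans[OF degree_mult_le add_mono[OF degree_pochhammer_linear]])
  then show "degree (pochhammer [:0, - 1:] i *
            (\<Sum>l = 0..N - i.
              smult (pochhammer (- of_nat N + of_nat i) l * pochhammer (\<gamma> - \<alpha> - \<beta> - of_nat N) l /
                     (pochhammer (\<gamma> - \<alpha> - of_nat N + of_nat i) l *
                      pochhammer (\<gamma> - \<beta> - of_nat N + of_nat i) l * fact l))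
                (pochhammer [:of_nat i, -1:] l))) \<le> N"
    using i by simp
qed

lemma poly_miller_paris2:
  "poly (miller_paris2 N \<alpha> \<beta> \<gamma> F) t =
     (\<Sum>i\<le>N. pochhammer \<alpha> i * pochhammer \<beta> i /
               (fact i * pochhammer (\<gamma> - \<alpha> - of_nat N) i * pochhammer (\<gamma> - \<beta> - of_nat N) i) *
               (\<Sum>j\<le>i. pochhammer (- of_nat i) j / fact j * poly F (of_nat j)) *
          (pochhammer (- t) i *
           (\<Sum>l\<le>N - i. pochhammer (- of_nat N + of_nat i) l * pochhammer (\<gamma> - \<alpha> - \<beta> - of_nat N) l /
                     (pochhammer (\<gamma> - \<alpha> - of_nat N + of_nat i) l *
                      pochhammer (\<gamma> - \<beta> - of_nat N + of_nat i) l * fact l) *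
                pochhammer (of_nat i - t) l)))"
  by (simp add: miller_paris2_def poly_sum poly_pochhammer atLeast0AtMost)

text \<open>
  The operator is characterised by the coefficients of
  $\sum_n (\alpha)_n(\beta)_n/((\gamma)_n n!)\, F(n) x^n
   = (1-x)^{\gamma-\alpha-\beta-N} \sum_n (\gamma-\alpha-N)_n(\gamma-\beta-N)_n/((\gamma)_n n!)\, \hat F(n) x^n$,
  here with the factor $(1-x)^{\gamma-\alpha-\beta-N}$ moved to the left and all denominators cleared.
\<close>

lemma miller_paris2_transformation:
  assumes deg: "degree F \<le> N" and dfd: "miller_paris2_defined N \<alpha> \<beta> \<gamma>"
  shows "pochhammer (\<gamma> - \<alpha> - of_nat N) v * pochhammer (\<gamma> - \<beta> - of_nat N) v *
           poly (miller_paris2 N \<alpha> \<beta> \<gamma> F) (of_nat v) =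
         (\<Sum>n\<le>v. of_nat (v choose n) * pochhammer \<alpha> n * pochhammer \<beta> n *
            pochhammer (\<gamma> + of_nat n) (v - n) * pochhammer (\<gamma> - \<alpha> - \<beta> - of_nat N) (v - n) *
            poly F (of_nat n))"
proof -
  define X Y s where "X = \<gamma> - \<alpha> - of_nat N" and "Y = \<gamma> - \<beta> - of_nat N"
    and "s = \<gamma> - \<alpha> - \<beta> - of_nat N"
  define \<phi> where "\<phi> i = (\<Sum>j\<le>i. pochhammer (- of_nat i) j / fact j * poly F (of_nat j))" for i
  define T where "T i l = pochhammer (- of_nat N + of_nat i) l * pochhammer s l /
      (pochhammer (X + of_nat i) l * pochhammer (Y + of_nat i) l * fact l) * pochhammer (of_nat i - of_nat v) l" for i l
  define W where "W n = of_nat (v choose n) * pochhammer \<alpha> n * pochhammer \<beta> n *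
            pochhammer (\<gamma> + of_nat n) (v - n) * pochhammer s (v - n)" for n
  have nz: "pochhammer X i \<noteq> 0" "pochhammer Y i \<noteq> 0" "l \<le> N - i \<Longrightarrow> pochhammer (X + of_nat i) l \<noteq> 0"
      "l \<le> N - i \<Longrightarrow> pochhammer (Y + of_nat i) l \<noteq> 0" if "i \<le> N" for i l
    using dfd that by (auto simp: miller_paris2_defined_def X_def Y_def)
  \<comment> \<open>By linearity in \<open>F\<close> it suffices to compare both sides on the Newton
    basis (-t)_i / i! with i \<le> N.\<close>
  have basis: "pochhammer X v * pochhammer Y v * (pochhammer \<alpha> i * pochhammer \<beta> i /
        (fact i * pochhammer X i * pochhammer Y i) * (pochhammer (- of_nat v) i * (\<Sum>l\<le>N - i. T i l))) =
      (\<Sum>n\<le>v. W n * (pochhammer (- of_nat n) i / fact i))" if i: "i \<le> N" for i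
  proof (cases "i \<le> v")
    case False
    then have "pochhammer (- of_nat n :: complex) i = 0" if "n \<le> v" for n
      using that by (intro pochhammer_of_nat_eq_0_lemma) simp
    then show ?thesis
      by simp
  next
    case True
    define n where "n = v - i"
    have v: "v = i + n" using True by (simp add: n_def)
    have T0: "T i l = 0" if "l > n" for l
    proof -
      have "of_nat i - of_nat v = (- of_nat n :: complex)" by (simp add: v)
      then show ?thesis
        using that by (simp add: T_def pochhammer_minus_of_nat)
    qed
    have T1: "T i l = 0" if "l > N - i" for l
    proof -
      have "- of_nat N + of_nat i = (- of_nat (N - i) :: complex)" using i by simp
      then show ?thesis
        using that by (simp only: T_def pochhammer_minus_of_nat) simp
    qed
    \<comment> \<open>Two factors of \<open>T\<close> cut off the sum, one beyond
      \<open>N - i\<close> and one beyond \<open>n\<close>, so either bound may replace the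
      other.\<close>
    have "(\<Sum>l\<le>N - i. T i l) = (\<Sum>l\<le>n. T i l)"
    proof (cases "N - i \<le> n")
      case True
      then show ?thesis by (intro sum.mono_neutral_left) (auto intro: T1)
    next
      case False
      then show ?thesis by (intro sum.mono_neutral_right) (auto intro: T0)
    qed
    then have "pochhammer X v * pochhammer Y v * (pochhammer \<alpha> i * pochhammer \<beta> i /
        (fact i * pochhammer X i * pochhammer Y i) * (pochhammer (- of_nat v) i * (\<Sum>l\<le>N - i. T i l))) =
      (-1) ^ i * of_nat (v choose i) * pochhammer \<alpha> i * pochhammer \<beta> i *
        (\<Sum>l\<le>n. pochhammer (X + of_nat i) n * pochhammer (Y + of_nat i) n * T i l)"
      using nz(1,2)[OF i]
      unfolding v pochhammer_product' pochhammer_minus_of_nat sum_distrib_left[symmetric]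
      by (simp del: of_nat_add)
    also have "(\<Sum>l\<le>n. pochhammer (X + of_nat i) n * pochhammer (Y + of_nat i) n * T i l) =
      (\<Sum>l\<le>n. of_nat (n choose l) * (-1) ^ l * pochhammer (- of_nat (N - i)) l * pochhammer s l *
        pochhammer (X + of_nat i + of_nat l) (n - l) * pochhammer (Y + of_nat i + of_nat l) (n - l))"
    proof (intro sum.cong refl)
      fix l assume "l \<in> {..n}"
      then have "l \<le> n" by simp
      show "pochhammer (X + of_nat i) n * pochhammer (Y + of_nat i) n * T i l = of_nat (n choose l) * (-1) ^ l *
         pochhammer (- of_nat (N - i)) l * pochhammer s l *
        pochhammer (X + of_nat i + of_nat l) (n - l) * pochhammer (Y + of_nat i + of_nat l) (n - l)"
      proof (cases "l \<le> N - i")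
        case False
        then show ?thesis using T1[of l] by (simp add: pochhammer_minus_of_nat)
      next
        case True
        have e: "- of_nat N + of_nat i = (- of_nat (N - i) :: complex)" using i by simp
        have e': "of_nat i - of_nat v = (- of_nat n :: complex)" by (simp add: v)
        have "pochhammer (X + of_nat i) n = pochhammer (X + of_nat i) l * pochhammer (X + of_nat i + of_nat l) (n - l)"
             "pochhammer (Y + of_nat i) n = pochhammer (Y + of_nat i) l * pochhammer (Y + of_nat i + of_nat l) (n - l)"
          using \<open>l \<le> n\<close> by (auto intro: pochhammer_product)
        then show ?thesis
          using nz(3,4)[OF i True] unfolding T_def e e' pochhammer_minus_of_nat[of n]
          by (simp del: of_nat_diff)
      qed
    qed
    also have "\<dots> = (\<Sum>h\<le>n. of_nat (n choose h) * pochhammer (\<alpha> + of_nat i) h * pochhammer (\<beta> + of_nat i) h *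
            pochhammer (\<gamma> + of_nat i + of_nat h) (n - h) * pochhammer s (n - h))"
    proof -
      \<comment> \<open>The 3F2 transformation is applied with all three parameters raised by
        \<open>i\<close> and with \<open>K = N - i\<close>.\<close>
      have *: "s = (\<gamma> + of_nat i) - (\<alpha> + of_nat i) - (\<beta> + of_nat i) - of_nat (N - i)"
        using i by (simp add: s_def)
      have "\<gamma> + of_nat i - (\<alpha> + of_nat i) - of_nat (N - i) = X + of_nat i"
           "\<gamma> + of_nat i - (\<beta> + of_nat i) - of_nat (N - i) = Y + of_nat i"
        using i by (simp_all add: X_def Y_def)
      then show ?thesis
        by (simp only: saalschuetz_extended[OF *])
    qed
    also have "(-1) ^ i * of_nat (v choose i) * pochhammer \<alpha> i * pochhammer \<beta> i * \<dots> =
      (\<Sum>h\<le>n. W (i + h) * (pochhammer (- of_nat (i + h)) i / fact i))"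
    proof (unfold sum_distrib_left, intro sum.cong refl, goal_cases)
      case (1 h)
      then have "i + h \<le> v" by (simp add: v)
      have "W (i + h) * (pochhammer (- of_nat (i + h)) i / fact i) = (of_nat (v choose (i + h)) * of_nat ((i + h) choose i)) * 
         ((-1) ^ i * pochhammer \<alpha> (i + h) * pochhammer \<beta> (i + h) *
            pochhammer (\<gamma> + of_nat (i + h)) (v - (i + h)) * pochhammer s (v - (i + h)))"
        by (simp only: pochhammer_minus_of_nat W_def) (simp del: of_nat_add)
      then show ?case
        unfolding choose_mult_of_nat[OF \<open>i + h \<le> v\<close>, symmetric]
        by (simp only: pochhammer_product' v add.assoc mult_ac of_nat_add diff_add_inverse diff_diff_left[symmetric])
    qed
    also have "\<dots> = (\<Sum>n\<in>{i..v}. W n * (pochhammer (- of_nat n) i / fact i))"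
      by (rule sum.reindex_bij_witness[of _ "\<lambda>m. m - i" "\<lambda>h. i + h"]) (auto simp: v)
    also have "\<dots> = (\<Sum>n\<le>v. W n * (pochhammer (- of_nat n) i / fact i))"
      by (rule sum.mono_neutral_left) (auto simp: pochhammer_minus_of_nat)
    finally show ?thesis .
  qed
  have "pochhammer X v * pochhammer Y v * poly (miller_paris2 N \<alpha> \<beta> \<gamma> F) (of_nat v) =
    (\<Sum>i\<le>N. \<phi> i * (pochhammer X v * pochhammer Y v * (pochhammer \<alpha> i * pochhammer \<beta> i /
        (fact i * pochhammer X i * pochhammer Y i) * (pochhammer (- of_nat v) i * (\<Sum>l\<le>N - i. T i l)))))"
    unfolding poly_miller_paris2 \<phi>_def[symmetric] X_def[symmetric] Y_def[symmetric] s_def[symmetric] T_def[symmetric]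
      sum_distrib_left[of "pochhammer X v * pochhammer Y v"]
    by (intro sum.cong refl) (simp only: mult_ac times_divide_eq_left times_divide_eq_right)
  also have "\<dots> = (\<Sum>i\<le>N. \<phi> i * (\<Sum>n\<le>v. W n * (pochhammer (- of_nat n) i / fact i)))"
    by (intro sum.cong refl) (simp only: basis atMost_iff)
  also have "\<dots> = (\<Sum>n\<le>v. \<Sum>i\<le>N. \<phi> i * (W n * (pochhammer (- of_nat n) i / fact i)))"
    unfolding sum_distrib_left by (rule sum.swap)
  also have "\<dots> = (\<Sum>n\<le>v. W n * poly F (of_nat n))"
  proof (intro sum.cong refl)
    fix n
    have "poly F (of_nat n) = (\<Sum>i\<le>N. \<phi> i * (pochhammer (- of_nat n) i / fact i))"
      unfolding \<phi>_def by (rule newton_expansion[OF deg])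
    then show "(\<Sum>i\<le>N. \<phi> i * (W n * (pochhammer (- of_nat n) i / fact i))) = W n * poly F (of_nat n)"
      by (simp only: sum_distrib_left mult.left_commute)
  qed
  finally show ?thesis
    by (simp add: W_def X_def Y_def s_def)
qed

section \<open>Well-poised expansions\<close>

text \<open>
  The expansion from the introduction, with $a = -k$, multiplied by $(1-k-p)_j (1-k/2)_j$.
\<close>

definition wp_sum :: "complex \<Rightarrow> complex \<Rightarrow> nat \<Rightarrow> complex poly \<Rightarrow> nat \<Rightarrow> complex" where
  "wp_sum k p M G j = (\<Sum>n\<le>j. of_nat (j choose n) * (-1) ^ n * pochhammer (of_nat j - k) n *
     pochhammer (1 - k / 2 - p - of_nat M) n * pochhammer (1 - k - p + of_nat n) (j - n) *
     pochhammer (1 - k / 2 + of_nat n) (j - n) * poly G (of_nat n))"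

text \<open>The second parameter is chosen so that \<gamma> - \<beta> - M = p. The operator's
  coefficient law at \<open>v\<close> then carries the factors (1 - k/2 - p' - M)_v, required by the
  expansion for \<open>p'\<close>, and (p)_v, which (p + v)_(j-v) completes to (p)_j. After
  exchanging the sums the inner one is balanced. The third parameter is always 1 - k/2, the lower
  parameter of the expansion that does not depend on \<open>p\<close>.\<close>

lemma wp_sum_miller_paris2:
  assumes deg: "degree G \<le> M"
    and dfd: "miller_paris2_defined M p' (1 - k / 2 - p - of_nat M) (1 - k / 2)"
  shows "pochhammer p j * wp_sum k p' M (miller_paris2 M p' (1 - k / 2 - p - of_nat M) (1 - k / 2) G) j =
         pochhammer p' j * wp_sum k p M G j"
proof -
  define \<gamma> \<beta> where "\<gamma> = 1 - k / 2" and "\<beta> = 1 - k / 2 - p - of_nat M"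
  define G' where "G' = miller_paris2 M p' \<beta> \<gamma> G"
  have tr: "pochhammer (1 - k / 2 - p' - of_nat M) v * pochhammer p v * poly G' (of_nat v) =
      (\<Sum>n\<le>v. of_nat (v choose n) * pochhammer p' n * pochhammer \<beta> n *
            pochhammer (\<gamma> + of_nat n) (v - n) * pochhammer (p - p') (v - n) * poly G (of_nat n))" for v
    using miller_paris2_transformation[OF deg dfd, of v]
    by (simp add: G'_def \<beta>_def \<gamma>_def)
  define S where "S n i = of_nat ((j - n) choose i) * (-1) ^ i * pochhammer (of_nat j - k + of_nat n) i * pochhammer (p - p') i *
     pochhammer (1 - k - p' + of_nat n + of_nat i) (j - n - i) * pochhammer (p + of_nat n + of_nat i) (j - n - i)" for n i
  have S: "(\<Sum>i\<le>j - n. S n i) = pochhammer (p' + of_nat n) (j - n) * pochhammer (1 - k - p + of_nat n) (j - n)"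
    if "n \<le> j" for n
  proof -
    have "(\<Sum>i\<le>j - n. S n i) = (-1) ^ (j - n) * pochhammer (1 - k - p' + of_nat n - (of_nat j - k + of_nat n)) (j - n) *
      pochhammer (1 - k - p' + of_nat n - (p - p')) (j - n)"
      unfolding S_def using that by (intro saalschuetz') (simp add: of_nat_diff)
    also have "1 - k - p' + of_nat n - (of_nat j - k + of_nat n) = 1 - (p' + of_nat n) - of_nat (j - n)"
      using that by (simp add: of_nat_diff)
    finally show ?thesis
      unfolding pochhammer_reflect by (simp add: algebra_simps)
  qed
  have "pochhammer p j * wp_sum k p' M G' j =
    (\<Sum>v\<le>j. of_nat (j choose v) * (-1) ^ v * pochhammer (of_nat j - k) v *
       pochhammer (1 - k - p' + of_nat v) (j - v) * pochhammer (\<gamma> + of_nat v) (j - v) * pochhammer (p + of_nat v) (j - v) *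
       (pochhammer (1 - k / 2 - p' - of_nat M) v * pochhammer p v * poly G' (of_nat v)))"
    unfolding wp_sum_def sum_distrib_left \<gamma>_def
    by (intro sum.cong refl) (simp add: pochhammer_product[of _ j p])
  also have "\<dots> = (\<Sum>v\<le>j. \<Sum>n\<le>v. of_nat (j choose v) * (-1) ^ v * pochhammer (of_nat j - k) v *
       pochhammer (1 - k - p' + of_nat v) (j - v) * pochhammer (\<gamma> + of_nat v) (j - v) * pochhammer (p + of_nat v) (j - v) *
       (of_nat (v choose n) * pochhammer p' n * pochhammer \<beta> n *
            pochhammer (\<gamma> + of_nat n) (v - n) * pochhammer (p - p') (v - n) * poly G (of_nat n)))"
    unfolding tr sum_distrib_left ..
  also have "\<dots> = (\<Sum>n\<le>j. \<Sum>i\<le>j - n. of_nat (j choose n) * (-1) ^ n * pochhammer (of_nat j - k) n *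
       pochhammer p' n * pochhammer \<beta> n * pochhammer (\<gamma> + of_nat n) (j - n) * poly G (of_nat n) * S n i)"
    unfolding sum_nested_triangle_swap
  proof (intro sum.cong refl, goal_cases)
    case (1 n i)
    then have le: "n + i \<le> j" and i: "i \<le> j - n" by auto
    have g: "pochhammer (\<gamma> + of_nat n) (j - n) = pochhammer (\<gamma> + of_nat n) i * pochhammer (\<gamma> + of_nat (n + i)) (j - (n + i))"
      using pochhammer_product[OF i, of "\<gamma> + of_nat n"] by (simp add: add.assoc)
    have "of_nat (j choose (n + i)) * (-1) ^ (n + i) * pochhammer (of_nat j - k) (n + i) *
       pochhammer (1 - k - p' + of_nat (n + i)) (j - (n + i)) * pochhammer (\<gamma> + of_nat (n + i)) (j - (n + i)) * pochhammer (p + of_nat (n + i)) (j - (n + i)) *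
       (of_nat ((n + i) choose n) * pochhammer p' n * pochhammer \<beta> n *
            pochhammer (\<gamma> + of_nat n) (n + i - n) * pochhammer (p - p') (n + i - n) * poly G (of_nat n)) =
      (of_nat (j choose (n + i)) * of_nat ((n + i) choose n)) * ((-1) ^ (n + i) * pochhammer (of_nat j - k) (n + i) *
       pochhammer (1 - k - p' + of_nat (n + i)) (j - (n + i)) * pochhammer (\<gamma> + of_nat (n + i)) (j - (n + i)) * pochhammer (p + of_nat (n + i)) (j - (n + i)) *
       (pochhammer p' n * pochhammer \<beta> n *
            pochhammer (\<gamma> + of_nat n) (n + i - n) * pochhammer (p - p') (n + i - n) * poly G (of_nat n)))"
      by (simp only: mult_ac)
    then show ?case
      unfolding choose_mult_of_nat[OF le, symmetric] g S_def
      by (simp add: pochhammer_product' power_add add.assoc mult_ac)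
  qed
  also have "\<dots> = pochhammer p' j * wp_sum k p M G j"
    unfolding wp_sum_def[of k p M G j] sum_distrib_left[of "pochhammer p' j"]
  proof (intro sum.cong refl, goal_cases)
    case (1 n)
    then have "n \<le> j" by simp
    then show ?case
      unfolding sum_distrib_left[symmetric]
      by (simp add: S pochhammer_product[of n j p'] \<beta>_def \<gamma>_def)
  qed
  finally show ?thesis
    by (simp add: G'_def \<beta>_def \<gamma>_def)
qed

text \<open>The sum of parameter and degree bound is the same on both sides, so only the symbol
  starting at \<open>1 - k - p + n\<close> changes. There (f+n)_m (f+m+n)_(j-n) and (f+n)_(j-n)
  (f+j)_m are two ways of splitting one symbol, and (f+j)_m does not depend on
  \<open>n\<close>.\<close>

lemma wp_sum_mult_pochhammer:
  "wp_sum k (1 - k - f - of_nat m) (M + m) (pochhammer [:f, 1:] m * G) j =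
   pochhammer (f + of_nat j) m * wp_sum k (1 - k - f) M G j"
  unfolding wp_sum_def sum_distrib_left
proof (intro sum.cong refl, goal_cases)
  case (1 n)
  then have n: "n \<le> j" by simp
  have "pochhammer (f + of_nat n) m * pochhammer (f + of_nat n + of_nat m) (j - n) =
        pochhammer (f + of_nat n) (j - n) * pochhammer (f + of_nat n + of_nat (j - n)) m"
    by (rule pochhammer_shift_swap)
  moreover have "f + of_nat n + of_nat (j - n) = f + of_nat j"
    using n by (simp add: of_nat_diff)
  moreover have "1 - k - (1 - k - f - of_nat m) + of_nat n = f + of_nat n + of_nat m"
    "1 - k / 2 - (1 - k - f - of_nat m) - of_nat (M + m) = 1 - k / 2 - (1 - k - f) - of_nat M"
    "1 - k - (1 - k - f) + of_nat n = f + of_nat n"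
    by simp_all
  moreover have "poly (pochhammer [:f, 1:] m * G) (of_nat n) = pochhammer (f + of_nat n) m * poly G (of_nat n)"
    by (simp add: poly_pochhammer)
  ultimately show ?case
    by (simp only: mult_ac) (simp only: mult.assoc[symmetric])
qed

text \<open>The start of the chain, with the empty product and \<open>G = 1\<close>, is a balanced
  sum. It produces the factor (-k/2)_j, which every later step carries along unchanged.\<close>

lemma wp_sum_base: "wp_sum k (1 - k - f) 0 1 j = pochhammer (1 - k - f) j * pochhammer (- k / 2) j"
proof -
  have "wp_sum k (1 - k - f) 0 1 j = (\<Sum>n\<le>j. of_nat (j choose n) * (-1) ^ n * pochhammer (of_nat j - k) n *
     pochhammer (f + k / 2) n * pochhammer (1 - k / 2 + of_nat n) (j - n) * pochhammer (f + of_nat n) (j - n))"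
    unfolding wp_sum_def by (intro sum.cong refl) (simp add: field_simps)
  also have "\<dots> = (-1) ^ j * pochhammer (1 - k / 2 - (of_nat j - k)) j * pochhammer (1 - k / 2 - (f + k / 2)) j"
    by (rule saalschuetz') (simp add: field_simps)
  also have "1 - k / 2 - (of_nat j - k) = 1 - (- k / 2) - of_nat j"
    by (simp add: field_simps)
  also have "1 - k / 2 - (f + k / 2) = 1 - k - f"
    by (simp add: field_simps)
  finally show ?thesis
    unfolding pochhammer_reflect by simp
qed

text \<open>Lowering the parameter by \<open>m\<close> leaves behind the mirror image (f+k-j)_m of
  (f+j)_m. Thus the product becomes symmetric under j -> k - j although \<open>G\<close> is
  multiplied by one factor only.\<close>

lemma pochhammer_complementary_pair:
  fixes f k :: "'a::field"
  assumes "pochhammer (f + k) m \<noteq> 0"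
  shows "pochhammer (1 - k - f) j =
         pochhammer (1 - k - f - of_nat m) j * (pochhammer (f + k - of_nat j) m / pochhammer (f + k) m)"
proof -
  have "pochhammer (1 - (f + k) - of_nat m) m * pochhammer (1 - k - f) j =
        pochhammer (1 - k - f - of_nat m) j * pochhammer (1 - (f + k - of_nat j) - of_nat m) m"
    using pochhammer_shift_swap[of "1 - k - f - of_nat m" m j] by (simp add: algebra_simps)
  then have "(-1) ^ m * ((-1) ^ m * pochhammer (f + k) m * pochhammer (1 - k - f) j) =
    (-1) ^ m * (pochhammer (1 - k - f - of_nat m) j * ((-1) ^ m * pochhammer (f + k - of_nat j) m))"
    unfolding pochhammer_reflect by simp
  then show ?thesis
    using assms by (simp add: field_simps)
qed

text \<open>The product Q(j) of the overview for a = -k, normalised to the product of the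
  (f_t)_(m_t) at j = 0 when no denominator vanishes. \<open>k\<close> is complex, since it passes
  through non-integral values before it is specialised.\<close>

definition sym_prod :: "(nat \<Rightarrow> complex) \<Rightarrow> (nat \<Rightarrow> nat) \<Rightarrow> complex \<Rightarrow> nat \<Rightarrow> nat \<Rightarrow> complex" where
  "sym_prod f m k s j = (\<Prod>t=1..s. pochhammer (f t + of_nat j) (m t) * pochhammer (f t + k - of_nat j) (m t) /
     pochhammer (f t + k) (m t))"

lemma wp_sum_G_poly:
  assumes "s \<ge> 1"
    and "\<And>t. t \<in> {1..s} \<Longrightarrow> pochhammer (f t + k) (m t) \<noteq> 0"
    and "\<And>t. t \<in> {1..s} \<Longrightarrow> pochhammer (1 - k - f t - of_nat (m t)) j \<noteq> 0"
    and "\<And>t. t \<in> {2..s} \<Longrightarrow> miller_paris2_defined (partial_sum m (t - 1)) (1 - k - f t)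
        (f (t - 1) + k / 2 - of_nat (partial_sum m (t - 2))) (1 - k / 2)"
  shows "degree (G_poly f m k s) \<le> partial_sum m s \<and>
    wp_sum k (1 - k - f s - of_nat (m s)) (partial_sum m s) (G_poly f m k s) j =
      pochhammer (1 - k - f s - of_nat (m s)) j * pochhammer (- k / 2) j * sym_prod f m k s j"
  using assms
proof (induction s rule: nat_induct_at_least)
  case base
  have "wp_sum k (1 - k - f 1 - of_nat (m 1)) (partial_sum m 1) (G_poly f m k 1) j =
     pochhammer (f 1 + of_nat j) (m 1) * wp_sum k (1 - k - f 1) 0 1 j"
    using wp_sum_mult_pochhammer[of k "f 1" "m 1" 0 1 j] by (simp add: partial_sum_def)
  also have "\<dots> = pochhammer (1 - k - f 1 - of_nat (m 1)) j * pochhammer (- k / 2) j * sym_prod f m k 1 j"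
    using base(1)[of 1]
    unfolding wp_sum_base by (subst pochhammer_complementary_pair) (simp_all add: sym_prod_def mult_ac)
  finally show ?case
    using degree_pochhammer_linear[of "f 1" 1 "m 1"] by (simp add: partial_sum_def)
next
  case (Suc s)
  then obtain n where n: "s = Suc n" by (cases s) auto
  define M where "M = partial_sum m s"
  define p p' where "p = 1 - k - f s - of_nat (m s)" and "p' = 1 - k - f (Suc s)"
  have M: "M = partial_sum m n + m s" "partial_sum m (Suc s) = M + m (Suc s)"
    by (simp_all add: M_def partial_sum_def n)
  have IH: "degree (G_poly f m k s) \<le> M"
    "wp_sum k p M (G_poly f m k s) j = pochhammer p j * pochhammer (- k / 2) j * sym_prod f m k s j"
    using Suc by (auto simp: M_def p_def)
  \<comment> \<open>The origin of the second parameter in \<open>G_poly\<close>: it is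
    \<open>1 - k / 2 - p - of_nat M\<close> for the parameter \<open>p\<close> reached after
    \<open>s\<close> factors.\<close>
  have b: "f s + k / 2 - of_nat (partial_sum m n) = 1 - k / 2 - p - of_nat M"
    by (simp add: p_def M field_simps)
  define G' where "G' = miller_paris2 M p' (1 - k / 2 - p - of_nat M) (1 - k / 2) (G_poly f m k s)"
  have G: "G_poly f m k (Suc s) = pochhammer [:f (Suc s), 1:] (m (Suc s)) * G'"
    unfolding n G_poly.simps Let_def G'_def M_def p'_def by (simp add: b[unfolded n M_def])
  have dfd: "miller_paris2_defined M p' (1 - k / 2 - p - of_nat M) (1 - k / 2)"
    using Suc.prems(3)[of "Suc s"] by (simp add: M_def p'_def b[unfolded n M_def] n)
  have pj: "pochhammer p j \<noteq> 0"
    using Suc.prems(2)[of s] \<open>1 \<le> s\<close> by (simp add: p_def)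
  have "pochhammer p j * wp_sum k p' M G' j = pochhammer p' j * wp_sum k p M (G_poly f m k s) j"
    unfolding G'_def by (rule wp_sum_miller_paris2[OF IH(1) dfd])
  then have "wp_sum k p' M G' j = pochhammer p' j * pochhammer (- k / 2) j * sym_prod f m k s j"
    using pj by (simp add: IH(2))
  then have "wp_sum k (p' - of_nat (m (Suc s))) (partial_sum m (Suc s)) (G_poly f m k (Suc s)) j =
     pochhammer (f (Suc s) + of_nat j) (m (Suc s)) * (pochhammer p' j * pochhammer (- k / 2) j * sym_prod f m k s j)"
    using wp_sum_mult_pochhammer[of k "f (Suc s)" "m (Suc s)" M G' j]
    by (simp add: G M(2) p'_def)
  also have "\<dots> = pochhammer (p' - of_nat (m (Suc s))) j * pochhammer (- k / 2) j * sym_prod f m k (Suc s) j"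
    using Suc.prems(1)[of "Suc s"]
    unfolding p'_def by (subst pochhammer_complementary_pair) (simp_all add: sym_prod_def mult_ac)
  finally have *: "wp_sum k (p' - of_nat (m (Suc s))) (partial_sum m (Suc s)) (G_poly f m k (Suc s)) j =
     pochhammer (p' - of_nat (m (Suc s))) j * pochhammer (- k / 2) j * sym_prod f m k (Suc s) j" .
  have "degree G' \<le> M"
    unfolding G'_def by (rule degree_miller_paris2)
  then have "degree (G_poly f m k (Suc s)) \<le> m (Suc s) + M"
    unfolding G by (intro order_trans[OF degree_mult_le] add_mono degree_pochhammer_linear)
  then show ?case
    using * by (simp add: M(2) p'_def add.commute)
qed

text \<open>This is \<open>a\<close> times the summand of the very-well-poised 3F2 with upper
  parameters a, 1 + a/2, -N. Writing a (1+a/2)_i / (a/2)_i as a + 2i avoids a division by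
  (a/2)_i.\<close>

definition vwp_term :: "'a::field_char_0 \<Rightarrow> nat \<Rightarrow> nat \<Rightarrow> 'a" where
  "vwp_term a N i = pochhammer a i * (a + 2 * of_nat i) * pochhammer (- of_nat N) i /
     (fact i * pochhammer (1 + a + of_nat N) i)"

text \<open>The sum telescopes: its partial sum up to \<open>I\<close> is a product containing
  (1-N)_I, which is zero at \<open>I = N\<close> unless \<open>N = 0\<close>. The result serves as
  an orthogonality relation that reduces a double sum to a single term.\<close>

lemma sum_vwp_term:
  assumes "pochhammer (1 + a + of_nat N) N \<noteq> 0"
  shows "(\<Sum>i\<le>N. vwp_term a N i) = (if N = 0 then a else 0)"
proof -
  have "(\<Sum>i\<le>I. vwp_term a N i) = pochhammer a (Suc I) * pochhammer (1 - of_nat N) I /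
      (fact I * pochhammer (1 + a + of_nat N) I)" if "I \<le> N" for I
    using that
  proof (induction I)
    case 0
    then show ?case by (simp add: vwp_term_def)
  next
    case (Suc I)
    have nz: "pochhammer (1 + a + of_nat N) I \<noteq> 0" "1 + a + of_nat N + of_nat I \<noteq> 0"
      using pochhammer_neq_0_mono[OF assms Suc.prems] by (auto simp: pochhammer_Suc)
    have f: "(of_nat (Suc I) :: 'a) \<noteq> 0" by (rule of_nat_neq_0)
    have r: "pochhammer (- of_nat N :: 'a) (Suc I) = - of_nat N * pochhammer (1 - of_nat N) I"
      by (simp add: pochhammer_rec)
    define P Q S where "P = pochhammer a (Suc I)" and "Q = pochhammer (1 - of_nat N :: 'a) I"
      and "S = pochhammer (1 + a + of_nat N) I"
    have "(\<Sum>i\<le>Suc I. vwp_term a N i) = P * Q / (fact I * S) + P * (a + 2 * of_nat (Suc I)) * (- of_nat N * Q) /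
       (of_nat (Suc I) * fact I * (S * (1 + a + of_nat N + of_nat I)))"
      using Suc by (simp add: vwp_term_def r P_def Q_def S_def pochhammer_Suc[of "1 + a + of_nat N" I])
    also have "P * Q / (fact I * S) = P * Q * (of_nat (Suc I) * (1 + a + of_nat N + of_nat I)) /
       (of_nat (Suc I) * fact I * (S * (1 + a + of_nat N + of_nat I)))"
      using nz f by (simp add: S_def del: of_nat_Suc)
    also have "\<dots> + P * (a + 2 * of_nat (Suc I)) * (- of_nat N * Q) /
       (of_nat (Suc I) * fact I * (S * (1 + a + of_nat N + of_nat I))) =
       P * (a + of_nat (Suc I)) * (Q * (1 - of_nat N + of_nat I)) / (of_nat (Suc I) * fact I * (S * (1 + a + of_nat N + of_nat I)))"
      unfolding add_divide_distrib[symmetric]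
      by (intro arg_cong2[of _ _ _ _ "(/)"] refl) (simp add: algebra_simps)
    also have "\<dots> = pochhammer a (Suc (Suc I)) * pochhammer (1 - of_nat N) (Suc I) /
      (fact (Suc I) * pochhammer (1 + a + of_nat N) (Suc I))"
      by (simp add: pochhammer_Suc[of _ "Suc I"] pochhammer_Suc[of "1 - of_nat N"] pochhammer_Suc[of "1 + a + of_nat N"] P_def Q_def S_def)
    finally show ?case .
  qed
  from this[of N] show ?thesis
    by (cases N) (simp_all add: pochhammer_of_nat_eq_0_lemma)
qed

text \<open>The multiplier is the basis function (-j)_n (a+j)_n / n! at j = n + i. It preserves the
  family of very-well-poised terms because (a)_(n+i) (a+n+i)_n = (a)_(2n) (a+2n)_i.\<close>

lemma vwp_term_shift:
  fixes a :: "'a::field_char_0"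
  assumes "n + i \<le> N"
  shows "vwp_term a N (n + i) * (of_nat ((n + i) choose n) * (-1) ^ n * pochhammer (a + of_nat (n + i)) n) =
     of_nat (N choose n) * pochhammer a (2 * n) / pochhammer (1 + a + of_nat N) n * vwp_term (a + 2 * of_nat n) (N - n) i"
proof -
  have 1: "pochhammer a (n + i) * pochhammer (a + of_nat (n + i)) n = pochhammer a (2 * n) * pochhammer (a + 2 * of_nat n) i"
  proof -
    have "pochhammer a (n + i + n) = pochhammer a (2 * n + i)"
      by (rule arg_cong) simp
    then show ?thesis
      unfolding pochhammer_product' by simp
  qed
  have 2: "pochhammer (- of_nat N :: 'a) (n + i) = (-1) ^ n * fact n * of_nat (N choose n) * pochhammer (- of_nat (N - n)) i"
    using assms by (simp add: pochhammer_product' pochhammer_minus_of_nat[of N n] of_nat_diff)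
  have "1 + (a + 2 * of_nat n) + of_nat (N - n) = 1 + a + of_nat N + of_nat n"
    using assms by (simp add: of_nat_diff)
  then have 3: "pochhammer (1 + a + of_nat N) (n + i) = pochhammer (1 + a + of_nat N) n * pochhammer (1 + (a + 2 * of_nat n) + of_nat (N - n)) i"
    by (simp only: pochhammer_product')
  have 4: "(of_nat ((n + i) choose n) :: 'a) = fact (n + i) / (fact n * fact i)"
    using binomial_fact[of n "n + i", where 'a='a] by simp
  have 5: "a + 2 * of_nat (n + i) = a + 2 * of_nat n + 2 * of_nat i"
    by simp
  have "vwp_term a N (n + i) * (of_nat ((n + i) choose n) * (-1) ^ n * pochhammer (a + of_nat (n + i)) n) =
    (pochhammer a (n + i) * pochhammer (a + of_nat (n + i)) n) * (a + 2 * of_nat (n + i)) * pochhammer (- of_nat N) (n + i) *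
    (-1) ^ n * (of_nat ((n + i) choose n) / fact (n + i)) / pochhammer (1 + a + of_nat N) (n + i)"
    by (simp add: vwp_term_def mult_ac del: of_nat_add)
  also have "\<dots> = of_nat (N choose n) * pochhammer a (2 * n) / pochhammer (1 + a + of_nat N) n * vwp_term (a + 2 * of_nat n) (N - n) i"
    unfolding 1 2 3 4 5 by (simp add: vwp_term_def mult_ac del: of_nat_diff)
  finally show ?thesis .
qed

section \<open>The very-well-poised sum\<close>

text \<open>Bailey's terminating very-well-poised ${}_5F_4$ sum with the parameter $d = (1 + a)/2 = 1 + a - d$.\<close>

lemma sum_vwp_term_pair:
  fixes a c D :: "'a::field_char_0"
  assumes D: "2 * D = 1 + a"
    and nz: "pochhammer (1 + a + of_nat N) N \<noteq> 0" "pochhammer (1 + a - c) N \<noteq> 0" "pochhammer D N \<noteq> 0"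
  shows "(\<Sum>i\<le>N. vwp_term a N i * (pochhammer c i / pochhammer (1 + a - c) i)) =
         a * pochhammer (1 + a) N * pochhammer (D - c) N / (pochhammer (1 + a - c) N * pochhammer D N)"
proof -
  define q where "q n = pochhammer (D - c) n / (pochhammer (1 + a - c) n * pochhammer D n)" for n
  \<comment> \<open>Pfaff-Saalschuetz develops the quotient in the same basis; since 1 + a - D = D,
    the symbol (1+a-D)_i in its value cancels (D)_i.\<close>
  have expand: "pochhammer c i / pochhammer (1 + a - c) i =
      (\<Sum>n\<le>i. of_nat (i choose n) * (-1) ^ n * pochhammer (a + of_nat i) n * q n)" if "i \<le> N" for i
  proof -
    have nz': "pochhammer (1 + a - c) i \<noteq> 0" "pochhammer D i \<noteq> 0"
      using nz pochhammer_neq_0_mono that by blast+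
    have "(\<Sum>n\<le>i. of_nat (i choose n) * (-1) ^ n * pochhammer (a + of_nat i) n * pochhammer (D - c) n *
        pochhammer (1 + a - c + of_nat n) (i - n) * pochhammer (D + of_nat n) (i - n)) =
      (-1) ^ i * pochhammer (1 + a - c - (a + of_nat i)) i * pochhammer (1 + a - c - (D - c)) i"
      by (rule saalschuetz') (use D in \<open>simp add: algebra_simps\<close>)
    also have "1 + a - c - (a + of_nat i) = 1 - c - of_nat i" by simp
    also have "1 + a - c - (D - c) = D" using D by (simp add: algebra_simps)
    finally have "pochhammer c i * pochhammer D i =
       (\<Sum>n\<le>i. of_nat (i choose n) * (-1) ^ n * pochhammer (a + of_nat i) n * pochhammer (D - c) n *
        pochhammer (1 + a - c + of_nat n) (i - n) * pochhammer (D + of_nat n) (i - n))"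
      unfolding pochhammer_reflect by simp
    also have "\<dots> = (\<Sum>n\<le>i. (pochhammer (1 + a - c) i * pochhammer D i) *
       (of_nat (i choose n) * (-1) ^ n * pochhammer (a + of_nat i) n * q n))"
    proof (intro sum.cong refl)
      fix n assume "n \<in> {..i}"
      then have n: "n \<le> i" by simp
      have "pochhammer (1 + a - c) n \<noteq> 0" "pochhammer D n \<noteq> 0"
        using nz' n pochhammer_neq_0_mono by blast+
      then show "of_nat (i choose n) * (-1) ^ n * pochhammer (a + of_nat i) n * pochhammer (D - c) n *
        pochhammer (1 + a - c + of_nat n) (i - n) * pochhammer (D + of_nat n) (i - n) =
        (pochhammer (1 + a - c) i * pochhammer D i) *
        (of_nat (i choose n) * (-1) ^ n * pochhammer (a + of_nat i) n * q n)"
        unfolding pochhammer_product[OF n, of "1 + a - c"] pochhammer_product[OF n, of D] q_def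
        by simp
    qed
    finally show ?thesis
      using nz' unfolding sum_distrib_left[symmetric] by (simp add: divide_simps mult_ac)
  qed
  have "(\<Sum>i\<le>N. vwp_term a N i * (pochhammer c i / pochhammer (1 + a - c) i)) =
    (\<Sum>i\<le>N. \<Sum>n\<le>i. vwp_term a N i * (of_nat (i choose n) * (-1) ^ n * pochhammer (a + of_nat i) n * q n))"
    by (simp add: expand sum_distrib_left)
  also have "\<dots> = (\<Sum>n\<le>N. \<Sum>i\<le>N - n. vwp_term a N (n + i) *
       (of_nat ((n + i) choose n) * (-1) ^ n * pochhammer (a + of_nat (n + i)) n) * q n)"
    unfolding sum_nested_triangle_swap by (intro sum.cong refl) (simp only: mult.assoc)
  also have "\<dots> = (\<Sum>n\<le>N. of_nat (N choose n) * pochhammer a (2 * n) / pochhammer (1 + a + of_nat N) n *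
       (\<Sum>i\<le>N - n. vwp_term (a + 2 * of_nat n) (N - n) i) * q n)"
    unfolding sum_distrib_left sum_distrib_right
  proof (intro sum.cong refl, goal_cases)
    case (1 n i)
    then have "n + i \<le> N" by auto
    then show ?case by (simp only: vwp_term_shift)
  qed
  \<comment> \<open>By orthogonality every inner sum with \<open>n < N\<close> vanishes.\<close>
  also have "\<dots> = (\<Sum>n\<in>{N}. of_nat (N choose n) * pochhammer a (2 * n) / pochhammer (1 + a + of_nat N) n *
       (\<Sum>i\<le>N - n. vwp_term (a + 2 * of_nat n) (N - n) i) * q n)"
  proof (rule sum.mono_neutral_right, simp, simp, intro ballI)
    fix n assume "n \<in> {..N} - {N}"
    then have n: "n < N" by auto
    have e: "1 + (a + 2 * of_nat n) + of_nat (N - n) = 1 + a + of_nat N + of_nat n"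
      using n by (simp add: of_nat_diff)
    have "pochhammer (1 + a + of_nat N) N = pochhammer (1 + a + of_nat N) n * pochhammer (1 + a + of_nat N + of_nat n) (N - n)"
      using n by (intro pochhammer_product) simp
    then have "pochhammer (1 + (a + 2 * of_nat n) + of_nat (N - n)) (N - n) \<noteq> 0"
      using nz(1) unfolding e by auto
    then have "(\<Sum>i\<le>N - n. vwp_term (a + 2 * of_nat n) (N - n) i) = 0"
      using n by (subst sum_vwp_term) auto
    then show "of_nat (N choose n) * pochhammer a (2 * n) / pochhammer (1 + a + of_nat N) n *
       (\<Sum>i\<le>N - n. vwp_term (a + 2 * of_nat n) (N - n) i) * q n = 0"
      by simp
  qed
  also have "\<dots> = pochhammer a (2 * N) * (a + 2 * of_nat N) / pochhammer (1 + a + of_nat N) N * q N"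
    by (simp add: sum_vwp_term vwp_term_def)
  also have "pochhammer a (2 * N) * (a + 2 * of_nat N) = a * (pochhammer (1 + a) N * pochhammer (1 + a + of_nat N) N)"
  proof -
    have "pochhammer a (2 * N) * (a + 2 * of_nat N) = a * pochhammer (a + 1) (2 * N)"
      using pochhammer_Suc[of a "2 * N"] pochhammer_rec[of a "2 * N"] by simp
    then show ?thesis
      by (simp only: mult_2 pochhammer_product' add.commute[of a 1])
  qed
  finally show ?thesis
    using nz(1) by (simp add: q_def)
qed

lemma pochhammer_half_quotient:
  fixes a :: "'a::field_char_0"
  assumes "pochhammer (a / 2) j \<noteq> 0"
  shows "a * pochhammer (1 + a / 2) j / pochhammer (a / 2) j = a + 2 * of_nat j"
proof -
  have "a / 2 * pochhammer (1 + a / 2) j = pochhammer (a / 2) j * (a / 2 + of_nat j)"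
    using pochhammer_Suc[of "a / 2" j] pochhammer_rec[of "a / 2" j] by (simp add: add.commute)
  then have "a * pochhammer (1 + a / 2) j = pochhammer (a / 2) j * (a + 2 * of_nat j)"
    by (simp add: field_simps)
  then show ?thesis
    using assms by simp
qed

text \<open>\<open>Q\<close> stays abstract, as only its expansion with parameter
  \<open>1 + a - d\<close> enters. After the exchange of sums the inner one is the very-well-poised
  sum with a + 2n, c + n and v - n; its closed form makes the sum over \<open>n\<close> the right
  side of the operator's coefficient law at \<open>v\<close>.\<close>

lemma terminating_product_sum_generic:
  fixes a c d :: complex and Q :: "nat \<Rightarrow> complex"
  assumes d: "d = 1 / 2 + c - of_nat v + of_nat M"
    and deg: "degree G \<le> M"
    and dfd: "miller_paris2_defined M c (1 / 2 + a / 2) (1 + a / 2)"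
    and wp: "\<And>j. j \<le> v \<Longrightarrow> wp_sum (- a) (1 + a - d) M G j = pochhammer (1 + a - d) j * pochhammer (a / 2) j * Q j"
    and nz: "a \<noteq> 0" "pochhammer (a / 2) v \<noteq> 0" "pochhammer (1 + a / 2) v \<noteq> 0" "pochhammer d v \<noteq> 0"
      "pochhammer (1 + a - c) v \<noteq> 0" "pochhammer (1 / 2 + a / 2) v \<noteq> 0" "pochhammer (1 + a + of_nat v) v \<noteq> 0"
  shows "(\<Sum>j\<le>v. pochhammer a j * pochhammer (- of_nat v) j * pochhammer c j * pochhammer (1 + a - d) j * Q j /
            (fact j * pochhammer (1 + a + of_nat v) j * pochhammer (1 + a - c) j * pochhammer d j)) =
         pochhammer (1 + a) v * pochhammer (1 / 2 + a / 2 - c) v *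
           (pochhammer (1 + a / 2 - c - of_nat M) v * pochhammer (1 / 2 - of_nat M) v *
            poly (miller_paris2 M c (1 / 2 + a / 2) (1 + a / 2) G) (of_nat v)) /
         (pochhammer (1 + a - c) v * pochhammer (1 / 2 + a / 2) v * pochhammer (1 + a / 2) v *
           pochhammer (1 / 2 - c - of_nat M) v)"
proof -
  define D where "D = 1 / 2 + a / 2"
  define b' where "b' = 1 / 2 + c - of_nat v - a / 2"
  define X where "X n = pochhammer b' n * poly G (of_nat n) / (pochhammer d n * pochhammer (1 + a / 2) n)" for n
  have nz': "pochhammer (a / 2) j \<noteq> 0" "pochhammer (1 + a / 2) j \<noteq> 0" "pochhammer d j \<noteq> 0"
      "pochhammer (1 + a - c) j \<noteq> 0" "pochhammer D j \<noteq> 0" if "j \<le> v" for j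
    using nz pochhammer_neq_0_mono that unfolding D_def by blast+
  have Q: "a * (pochhammer (1 + a - d) j * Q j / pochhammer d j) =
     (a + 2 * of_nat j) * (\<Sum>n\<le>j. of_nat (j choose n) * (-1) ^ n * pochhammer (a + of_nat j) n * X n)"
    if j: "j \<le> v" for j
  proof -
    have "pochhammer (1 + a - d) j * pochhammer (a / 2) j * Q j =
      (\<Sum>n\<le>j. of_nat (j choose n) * (-1) ^ n * pochhammer (of_nat j - - a) n *
     pochhammer (1 - - a / 2 - (1 + a - d) - of_nat M) n * pochhammer (1 - - a - (1 + a - d) + of_nat n) (j - n) *
     pochhammer (1 - - a / 2 + of_nat n) (j - n) * poly G (of_nat n))"
      unfolding wp[OF j, symmetric] wp_sum_def ..
    also have "\<dots> = (\<Sum>n\<le>j. (pochhammer d j * pochhammer (1 + a / 2) j) *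
       (of_nat (j choose n) * (-1) ^ n * pochhammer (a + of_nat j) n * X n))"
    proof (intro sum.cong refl)
      fix n assume "n \<in> {..j}"
      then have n: "n \<le> j" by simp
      have e: "of_nat j - - a = a + of_nat j" "1 - - a / 2 - (1 + a - d) - of_nat M = b'"
        "1 - - a - (1 + a - d) + of_nat n = d + of_nat n" "1 - - a / 2 + of_nat n = 1 + a / 2 + of_nat n"
        by (simp_all add: b'_def d field_simps)
      have nn: "pochhammer d n \<noteq> 0" "pochhammer (1 + a / 2) n \<noteq> 0"
        using nz'[of n] n j by auto
      show "of_nat (j choose n) * (-1) ^ n * pochhammer (of_nat j - - a) n *
     pochhammer (1 - - a / 2 - (1 + a - d) - of_nat M) n * pochhammer (1 - - a - (1 + a - d) + of_nat n) (j - n) *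
     pochhammer (1 - - a / 2 + of_nat n) (j - n) * poly G (of_nat n) =
       (pochhammer d j * pochhammer (1 + a / 2) j) *
       (of_nat (j choose n) * (-1) ^ n * pochhammer (a + of_nat j) n * X n)"
        unfolding e X_def pochhammer_product[OF n, of d] pochhammer_product[OF n, of "1 + a / 2"]
        using nn by simp
    qed
    also have "\<dots> = pochhammer d j * pochhammer (1 + a / 2) j *
       (\<Sum>n\<le>j. of_nat (j choose n) * (-1) ^ n * pochhammer (a + of_nat j) n * X n)"
      by (rule sum_distrib_left[symmetric])
    finally have "pochhammer (1 + a - d) j * Q j / pochhammer d j =
      pochhammer (1 + a / 2) j / pochhammer (a / 2) j *
       (\<Sum>n\<le>j. of_nat (j choose n) * (-1) ^ n * pochhammer (a + of_nat j) n * X n)"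
      using nz'[OF j] by (simp add: divide_simps mult_ac)
    then show ?thesis
      unfolding pochhammer_half_quotient[OF nz'(1)[OF j], symmetric] by simp
  qed
  have closed: "of_nat (v choose n) * pochhammer a (2 * n) / pochhammer (1 + a + of_nat v) n *
       (pochhammer c n / pochhammer (1 + a - c) n) *
       (\<Sum>i\<le>v - n. vwp_term (a + 2 * of_nat n) (v - n) i * (pochhammer (c + of_nat n) i / pochhammer (1 + a - c + of_nat n) i)) * X n =
     a * (pochhammer (1 + a) v * pochhammer (D - c) v / (pochhammer (1 + a - c) v * pochhammer D v * pochhammer (1 + a / 2) v *
        pochhammer (1 / 2 - c - of_nat M) v)) *
      (of_nat (v choose n) * pochhammer c n * pochhammer D n * pochhammer (1 + a / 2 + of_nat n) (v - n) *
       pochhammer (1 / 2 - c - of_nat M) (v - n) * poly G (of_nat n))"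
    if n: "n \<le> v" for n
  proof -
    define N where "N = v - n"
    have v: "v = n + N" using n by (simp add: N_def)
    have e: "1 + (a + 2 * of_nat n) + of_nat N = 1 + a + of_nat v + of_nat n" "1 + (a + 2 * of_nat n) - (c + of_nat n) = 1 + a - c + of_nat n"
      by (simp_all add: v)
    have sp: "pochhammer (1 + a + of_nat v) v = pochhammer (1 + a + of_nat v) n * pochhammer (1 + a + of_nat v + of_nat n) N"
      "pochhammer (1 + a - c) v = pochhammer (1 + a - c) n * pochhammer (1 + a - c + of_nat n) N"
      "pochhammer D v = pochhammer D n * pochhammer (D + of_nat n) N"
      "pochhammer (1 + a / 2) v = pochhammer (1 + a / 2) n * pochhammer (1 + a / 2 + of_nat n) N"
      using n by (simp_all add: pochhammer_product N_def)
    have nzs: "pochhammer (1 + a + of_nat v) n \<noteq> 0" "pochhammer (1 + a + of_nat v + of_nat n) N \<noteq> 0"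
      "pochhammer (1 + a - c) n \<noteq> 0" "pochhammer (1 + a - c + of_nat n) N \<noteq> 0"
      "pochhammer D n \<noteq> 0" "pochhammer (D + of_nat n) N \<noteq> 0"
      "pochhammer (1 + a / 2) n \<noteq> 0" "pochhammer (1 + a / 2 + of_nat n) N \<noteq> 0"
      using nz sp by (auto simp: D_def)
    have "(\<Sum>i\<le>N. vwp_term (a + 2 * of_nat n) N i * (pochhammer (c + of_nat n) i / pochhammer (1 + (a + 2 * of_nat n) - (c + of_nat n)) i)) =
      (a + 2 * of_nat n) * pochhammer (1 + (a + 2 * of_nat n)) N * pochhammer (D + of_nat n - (c + of_nat n)) N /
        (pochhammer (1 + (a + 2 * of_nat n) - (c + of_nat n)) N * pochhammer (D + of_nat n) N)"
      by (rule sum_vwp_term_pair, unfold e) (use nzs in \<open>simp_all add: D_def field_simps\<close>)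
    then have 1: "(\<Sum>i\<le>N. vwp_term (a + 2 * of_nat n) N i * (pochhammer (c + of_nat n) i / pochhammer (1 + a - c + of_nat n) i)) =
      (a + 2 * of_nat n) * pochhammer (1 + (a + 2 * of_nat n)) N * pochhammer (D - c) N /
        (pochhammer (1 + a - c + of_nat n) N * pochhammer (D + of_nat n) N)"
      unfolding e by simp
    have 2: "pochhammer a (2 * n) * ((a + 2 * of_nat n) * pochhammer (1 + (a + 2 * of_nat n)) N) =
       a * pochhammer (1 + a) v * pochhammer (1 + a + of_nat v) n"
    proof -
      have "pochhammer a (2 * n + Suc N) = pochhammer a (Suc (v + n))"
        by (rule arg_cong) (simp add: v)
      then have "pochhammer a (2 * n) * pochhammer (a + of_nat (2 * n)) (Suc N) = a * pochhammer (a + 1) (v + n)"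
        by (simp only: pochhammer_product' pochhammer_rec)
      then show ?thesis
        unfolding pochhammer_product'[of _ v n] pochhammer_rec by (simp add: add_ac mult_ac)
    qed
    \<comment> \<open>The value of \<open>d\<close> makes the symbol from the expansion and the one
      from the very-well-poised sum join to a symbol of length \<open>v\<close>, with
      \<open>n\<close> left only in a sign. The next identity produces the same sign and the factor
      (1/2 - c - M)_(v-n), whose parameter is \<gamma> - \<alpha> - \<beta> - M for the last
      operator.\<close>
    have 3: "pochhammer b' n * pochhammer (D - c) N = (-1) ^ n * pochhammer (D - c) v"
    proof -
      have "b' = 1 - (D - c + of_nat N) - of_nat n"
        by (simp add: b'_def D_def v field_simps)
      then show ?thesis
        by (simp only: pochhammer_reflect v add.commute[of n N] pochhammer_product' mult_ac)
    qed
    have 4: "pochhammer d n * pochhammer (1 / 2 - c - of_nat M) N = (-1) ^ n * pochhammer (1 / 2 - c - of_nat M) v"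
    proof -
      have "d = 1 - (1 / 2 - c - of_nat M + of_nat N) - of_nat n"
        by (simp add: d v field_simps)
      then show ?thesis
        by (simp only: pochhammer_reflect v add.commute[of n N] pochhammer_product' mult_ac)
    qed
    have nz4: "pochhammer (1 / 2 - c - of_nat M) v \<noteq> 0" "pochhammer (1 / 2 - c - of_nat M) N \<noteq> 0" "pochhammer d n \<noteq> 0"
    proof -
      have "d = 1 - (1 / 2 - c - of_nat M) - of_nat v"
        by (simp add: d field_simps)
      then have "pochhammer d v = (-1) ^ v * pochhammer (1 / 2 - c - of_nat M) v"
        by (simp only: pochhammer_reflect)
      then show z: "pochhammer (1 / 2 - c - of_nat M) v \<noteq> 0"
        using nz(4) by auto
      show "pochhammer (1 / 2 - c - of_nat M) N \<noteq> 0"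
        by (rule pochhammer_neq_0_mono[OF z]) (simp add: v)
      show "pochhammer d n \<noteq> 0" using nz'[OF n] by simp
    qed
    have "pochhammer b' n * pochhammer (D - c) N * pochhammer (1 / 2 - c - of_nat M) v =
       pochhammer (D - c) v * (pochhammer d n * pochhammer (1 / 2 - c - of_nat M) N)"
      unfolding 3 4 by (simp only: mult_ac)
    then have 5: "pochhammer b' n * pochhammer (D - c) N / pochhammer d n =
       pochhammer (D - c) v * pochhammer (1 / 2 - c - of_nat M) N / pochhammer (1 / 2 - c - of_nat M) v"
      using nz4 by (simp add: frac_eq_eq mult_ac)
    have "of_nat (v choose n) * pochhammer a (2 * n) / pochhammer (1 + a + of_nat v) n *
       (pochhammer c n / pochhammer (1 + a - c) n) *
       ((a + 2 * of_nat n) * pochhammer (1 + (a + 2 * of_nat n)) N * pochhammer (D - c) N /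
        (pochhammer (1 + a - c + of_nat n) N * pochhammer (D + of_nat n) N)) * X n =
      of_nat (v choose n) * (pochhammer a (2 * n) * ((a + 2 * of_nat n) * pochhammer (1 + (a + 2 * of_nat n)) N)) * pochhammer c n *
       (pochhammer b' n * pochhammer (D - c) N / pochhammer d n) * poly G (of_nat n) /
      (pochhammer (1 + a + of_nat v) n * (pochhammer (1 + a - c) n * pochhammer (1 + a - c + of_nat n) N) *
        pochhammer (D + of_nat n) N * pochhammer (1 + a / 2) n)"
      by (simp add: X_def mult_ac)
    also have "\<dots> = a * (pochhammer (1 + a) v * pochhammer (D - c) v / (pochhammer (1 + a - c) v * pochhammer D v * pochhammer (1 + a / 2) v *
        pochhammer (1 / 2 - c - of_nat M) v)) *
      (of_nat (v choose n) * pochhammer c n * pochhammer D n * pochhammer (1 + a / 2 + of_nat n) N *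
       pochhammer (1 / 2 - c - of_nat M) N * poly G (of_nat n))"
      unfolding 2 5 sp(2-4) using nzs by (simp add: mult_ac)
    finally show ?thesis
      using 1 by (simp add: N_def)
  qed
  have "a * (\<Sum>j\<le>v. pochhammer a j * pochhammer (- of_nat v) j * pochhammer c j * pochhammer (1 + a - d) j * Q j /
            (fact j * pochhammer (1 + a + of_nat v) j * pochhammer (1 + a - c) j * pochhammer d j)) =
    (\<Sum>j\<le>v. pochhammer a j * pochhammer (- of_nat v) j * (pochhammer c j / pochhammer (1 + a - c) j) /
            (fact j * pochhammer (1 + a + of_nat v) j) * (a * (pochhammer (1 + a - d) j * Q j / pochhammer d j)))"
    unfolding sum_distrib_left by (intro sum.cong refl) (simp add: mult_ac)
  also have "\<dots> = (\<Sum>j\<le>v. \<Sum>n\<le>j. vwp_term a v j * (of_nat (j choose n) * (-1) ^ n * pochhammer (a + of_nat j) n) *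
      (pochhammer c j / pochhammer (1 + a - c) j) * X n)"
  proof (intro sum.cong refl, goal_cases)
    case (1 j)
    then have "j \<le> v" by simp
    show ?case
      unfolding Q[OF \<open>j \<le> v\<close>] sum_distrib_left vwp_term_def
      by (intro sum.cong refl) (simp add: mult_ac)
  qed
  also have "\<dots> = (\<Sum>n\<le>v. \<Sum>i\<le>v - n. vwp_term a v (n + i) * (of_nat ((n + i) choose n) * (-1) ^ n * pochhammer (a + of_nat (n + i)) n) *
      (pochhammer c (n + i) / pochhammer (1 + a - c) (n + i)) * X n)"
    by (rule sum_nested_triangle_swap)
  also have "\<dots> = (\<Sum>n\<le>v. of_nat (v choose n) * pochhammer a (2 * n) / pochhammer (1 + a + of_nat v) n *
       (pochhammer c n / pochhammer (1 + a - c) n) *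
       (\<Sum>i\<le>v - n. vwp_term (a + 2 * of_nat n) (v - n) i * (pochhammer (c + of_nat n) i / pochhammer (1 + a - c + of_nat n) i)) * X n)"
    unfolding sum_distrib_left sum_distrib_right
  proof (intro sum.cong refl, goal_cases)
    case (1 n i)
    then have "n + i \<le> v" by auto
    then show ?case
      by (simp only: vwp_term_shift) (simp add: pochhammer_product' mult_ac)
  qed
  also have "\<dots> = a * ((pochhammer (1 + a) v * pochhammer (D - c) v / (pochhammer (1 + a - c) v * pochhammer D v * pochhammer (1 + a / 2) v *
        pochhammer (1 / 2 - c - of_nat M) v)) *
      (\<Sum>n\<le>v. of_nat (v choose n) * pochhammer c n * pochhammer D n * pochhammer (1 + a / 2 + of_nat n) (v - n) *
       pochhammer (1 / 2 - c - of_nat M) (v - n) * poly G (of_nat n)))"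
  proof -
    have "a * (K * (\<Sum>n\<le>v. R n)) = (\<Sum>n\<le>v. a * K * R n)" for K and R :: "nat \<Rightarrow> complex"
      by (simp add: sum_distrib_left mult.assoc)
    then show ?thesis
      by (simp only:) (intro sum.cong refl closed, simp)
  qed
  also have "(\<Sum>n\<le>v. of_nat (v choose n) * pochhammer c n * pochhammer D n * pochhammer (1 + a / 2 + of_nat n) (v - n) *
       pochhammer (1 / 2 - c - of_nat M) (v - n) * poly G (of_nat n)) =
     pochhammer (1 + a / 2 - c - of_nat M) v * pochhammer (1 / 2 - of_nat M) v *
            poly (miller_paris2 M c (1 / 2 + a / 2) (1 + a / 2) G) (of_nat v)"
  proof -
    have "1 + a / 2 - c - (1 / 2 + a / 2) - of_nat M = 1 / 2 - c - of_nat M"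
      "1 + a / 2 - (1 / 2 + a / 2) - of_nat M = 1 / 2 - of_nat M"
      by (simp_all add: field_simps)
    then show ?thesis
      using miller_paris2_transformation[OF deg dfd, of v] by (simp add: D_def)
  qed
  finally show ?thesis
    using nz(1) unfolding mult_cancel_left by (simp add: D_def mult_ac)
qed

section \<open>Rational functions on a set\<close>

text \<open>One pair of polynomials serves the whole set, and the denominator has no zero on it. As
  division by zero gives zero, an expression is rational only where its denominators survive;
  recording this set lets identities extend to each of its points and not merely to almost
  all.\<close>

definition ratfun_on :: "complex set \<Rightarrow> (complex \<Rightarrow> complex) \<Rightarrow> bool" where
  "ratfun_on D F \<longleftrightarrow> (\<exists>p q. \<forall>x\<in>D. poly q x \<noteq> 0 \<and> F x = poly p x / poly q x)"

lemma ratfun_on_const: "ratfun_on D (\<lambda>_. c)"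
  unfolding ratfun_on_def by (rule exI[of _ "[:c:]"], rule exI[of _ 1]) simp

lemma ratfun_on_ident: "ratfun_on D (\<lambda>x. x)"
  unfolding ratfun_on_def by (rule exI[of _ "[:0, 1:]"], rule exI[of _ 1]) simp

lemma ratfun_on_add:
  assumes "ratfun_on D F" "ratfun_on D G"
  shows "ratfun_on D (\<lambda>x. F x + G x)"
proof -
  obtain p q p' q' where "\<forall>x\<in>D. poly q x \<noteq> 0 \<and> F x = poly p x / poly q x"
    "\<forall>x\<in>D. poly q' x \<noteq> 0 \<and> G x = poly p' x / poly q' x"
    using assms unfolding ratfun_on_def by blast
  then have "\<forall>x\<in>D. poly (q * q') x \<noteq> 0 \<and> F x + G x = poly (p * q' + p' * q) x / poly (q * q') x"
    by (simp add: add_frac_eq mult.commute)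
  then show ?thesis unfolding ratfun_on_def by blast
qed

lemma ratfun_on_mult:
  assumes "ratfun_on D F" "ratfun_on D G"
  shows "ratfun_on D (\<lambda>x. F x * G x)"
proof -
  obtain p q p' q' where "\<forall>x\<in>D. poly q x \<noteq> 0 \<and> F x = poly p x / poly q x"
    "\<forall>x\<in>D. poly q' x \<noteq> 0 \<and> G x = poly p' x / poly q' x"
    using assms unfolding ratfun_on_def by blast
  then have "\<forall>x\<in>D. poly (q * q') x \<noteq> 0 \<and> F x * G x = poly (p * p') x / poly (q * q') x"
    by simp
  then show ?thesis unfolding ratfun_on_def by blast
qed

lemma ratfun_on_divide:
  assumes "ratfun_on D F" "ratfun_on D G" "\<And>x. x \<in> D \<Longrightarrow> G x \<noteq> 0"
  shows "ratfun_on D (\<lambda>x. F x / G x)"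
proof -
  obtain p q p' q' where "\<forall>x\<in>D. poly q x \<noteq> 0 \<and> F x = poly p x / poly q x"
    "\<forall>x\<in>D. poly q' x \<noteq> 0 \<and> G x = poly p' x / poly q' x"
    using assms(1,2) unfolding ratfun_on_def by blast
  moreover from this have "\<forall>x\<in>D. poly p' x \<noteq> 0"
    using assms(3) by force
  ultimately have "\<forall>x\<in>D. poly (q * p') x \<noteq> 0 \<and> F x / G x = poly (p * q') x / poly (q * p') x"
    by simp
  then show ?thesis unfolding ratfun_on_def by blast
qed

lemma ratfun_on_uminus:
  assumes "ratfun_on D F"
  shows "ratfun_on D (\<lambda>x. - F x)"
  using ratfun_on_mult[OF ratfun_on_const[of D "-1"] assms] by simp

lemma ratfun_on_diff:
  assumes "ratfun_on D F" "ratfun_on D G"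
  shows "ratfun_on D (\<lambda>x. F x - G x)"
  using ratfun_on_add[OF assms(1) ratfun_on_uminus[OF assms(2)]] by simp

lemma ratfun_on_sum:
  assumes "\<And>i. i \<in> A \<Longrightarrow> ratfun_on D (F i)"
  shows "ratfun_on D (\<lambda>x. \<Sum>i\<in>A. F i x)"
  using assms by (induction A rule: infinite_finite_induct) (auto intro: ratfun_on_const ratfun_on_add)

lemma ratfun_on_prod:
  assumes "\<And>i. i \<in> A \<Longrightarrow> ratfun_on D (F i)"
  shows "ratfun_on D (\<lambda>x. \<Prod>i\<in>A. F i x)"
  using assms by (induction A rule: infinite_finite_induct) (auto intro: ratfun_on_const ratfun_on_mult)

lemma ratfun_on_pochhammer:
  assumes "ratfun_on D F"
  shows "ratfun_on D (\<lambda>x. pochhammer (F x) n)"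
  unfolding pochhammer_prod by (intro ratfun_on_prod ratfun_on_add assms ratfun_on_const)

lemmas ratfun_on_intros = ratfun_on_const ratfun_on_ident ratfun_on_add ratfun_on_mult ratfun_on_uminus
  ratfun_on_diff ratfun_on_sum ratfun_on_prod ratfun_on_pochhammer

text \<open>The cross-multiplied difference is a polynomial with infinitely many roots. No topology
  is involved, so \<open>A\<close> may be any infinite subset of \<open>D\<close>, for instance one
  of negative integers.\<close>

lemma ratfun_on_identity:
  assumes "ratfun_on D F" "ratfun_on D G" "infinite A" "A \<subseteq> D" "\<And>x. x \<in> A \<Longrightarrow> F x = G x" "x \<in> D"
  shows "F x = G x"
proof -
  obtain p q p' q' where pq: "\<And>x. x \<in> D \<Longrightarrow> poly q x \<noteq> 0 \<and> F x = poly p x / poly q x"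
    "\<And>x. x \<in> D \<Longrightarrow> poly q' x \<noteq> 0 \<and> G x = poly p' x / poly q' x"
    using assms(1,2) unfolding ratfun_on_def by metis
  have "A \<subseteq> {x. poly (p * q' - p' * q) x = 0}"
  proof
    fix x assume "x \<in> A"
    then show "x \<in> {x. poly (p * q' - p' * q) x = 0}"
      using assms(4,5) pq[of x] by (auto simp: frac_eq_eq subset_iff)
  qed
  then have "p * q' - p' * q = 0"
    using poly_roots_finite \<open>infinite A\<close> finite_subset by blast
  then have "poly (p * q' - p' * q) x = 0" by simp
  then show ?thesis
    using pq[OF \<open>x \<in> D\<close>] by (simp add: frac_eq_eq)
qed

text \<open>The operator sees its argument only through values at natural numbers, so rational
  dependence on \<open>x\<close> is asked of these values and not of the coefficients.\<close>

lemma ratfun_on_miller_paris2: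
  assumes "ratfun_on D \<alpha>" "ratfun_on D \<beta>" "ratfun_on D \<gamma>" "ratfun_on D t"
    and F: "\<And>j. ratfun_on D (\<lambda>x. poly (F x) (of_nat j))"
    and dfd: "\<And>x. x \<in> D \<Longrightarrow> miller_paris2_defined N (\<alpha> x) (\<beta> x) (\<gamma> x)"
  shows "ratfun_on D (\<lambda>x. poly (miller_paris2 N (\<alpha> x) (\<beta> x) (\<gamma> x) (F x)) (t x))"
  unfolding poly_miller_paris2
  by (intro ratfun_on_intros ratfun_on_divide assms(1-4) F)
    (use dfd in \<open>auto simp: miller_paris2_defined_def\<close>)

text \<open>The induction needs \<open>t\<close> arbitrary: the result is wanted at
  \<open>t x\<close>, while the operator evaluates the preceding polynomial at constants.\<close>

lemma ratfun_on_G_poly: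
  assumes "ratfun_on D k" "ratfun_on D t"
    and "\<And>x u. x \<in> D \<Longrightarrow> u \<in> {2..s} \<Longrightarrow> miller_paris2_defined (partial_sum m (u - 1)) (1 - k x - f u)
        (f (u - 1) + k x / 2 - of_nat (partial_sum m (u - 2))) (1 - k x / 2)"
  shows "ratfun_on D (\<lambda>x. poly (G_poly f m (k x) s) (t x))"
  using assms(2,3)
proof (induction s arbitrary: t rule: less_induct)
  case (less s)
  consider "s = 0" | "s = 1" | n where "s = Suc (Suc n)"
    by (metis One_nat_def not0_implies_Suc)
  then show ?case
  proof cases
    case 3
    have "ratfun_on D (\<lambda>x. poly (G_poly f m (k x) (Suc n)) (of_nat j))" for j
      using less.prems(2) by (intro less.IH ratfun_on_const) (auto simp: 3)
    moreover have "miller_paris2_defined (partial_sum m (s - 1)) (1 - k x - f s)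
        (f (s - 1) + k x / 2 - of_nat (partial_sum m (s - 2))) (1 - k x / 2)" if "x \<in> D" for x
      using less.prems(2)[OF that, of s] by (simp add: 3)
    ultimately show ?thesis
      unfolding 3 G_poly.simps Let_def poly_mult poly_pochhammer
      by (intro ratfun_on_mult ratfun_on_pochhammer ratfun_on_miller_paris2 ratfun_on_diff ratfun_on_add
          ratfun_on_divide ratfun_on_const assms(1) less.prems(1))
        (simp_all add: ratfun_on_add ratfun_on_const less.prems(1))
  qed (simp_all add: poly_pochhammer ratfun_on_intros less.prems(1))
qed

lemma ratfun_on_R_hat:
  assumes "ratfun_on D b" "ratfun_on D c" "ratfun_on D k" "ratfun_on D t"
    and dfd: "\<And>x. x \<in> D \<Longrightarrow> R_defined (b x) (c x) r f m (k x)"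
  shows "ratfun_on D (\<lambda>x. poly (R_hat (b x) (c x) r f m (k x)) (t x))"
proof -
  have half: "ratfun_on D (\<lambda>x. k x / 2)"
    by (intro ratfun_on_divide ratfun_on_const assms) simp
  show ?thesis
    unfolding R_hat_def Let_def
    by (intro ratfun_on_miller_paris2 ratfun_on_G_poly ratfun_on_add ratfun_on_diff ratfun_on_const assms(1-4) half)
      (use dfd in \<open>auto simp: R_defined_def Let_def\<close>)
qed

lemma ratfun_on_R_fun:
  assumes "ratfun_on D b" "ratfun_on D c" "ratfun_on D k"
    and dfd: "\<And>x. x \<in> D \<Longrightarrow> R_defined (b x) (c x) r f m (k x)"
  shows "ratfun_on D (\<lambda>x. R_fun (b x) (c x) r f m (k x))"
proof -
  have half: "ratfun_on D (\<lambda>x. k x / 2)"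
    by (intro ratfun_on_divide ratfun_on_const assms) simp
  show ?thesis
    unfolding R_fun_def
    by (intro ratfun_on_mult ratfun_on_R_hat ratfun_on_divide ratfun_on_prod ratfun_on_pochhammer ratfun_on_add
        ratfun_on_uminus ratfun_on_const assms(1-3) half)
      (use dfd in \<open>auto simp: R_defined_def Let_def\<close>)
qed

section \<open>Points at which no denominator vanishes\<close>

lemma pochhammer_nonzero_if_notin_Ints:
  fixes x :: complex
  assumes "x \<notin> \<int>"
  shows "pochhammer x n \<noteq> 0"
  using assms by (auto simp: pochhammer_eq_0_iff)

lemma Im_nonzero_notin_Ints: "Im x \<noteq> 0 \<Longrightarrow> x \<notin> \<int>"
  by (auto elim!: Ints_cases)

lemma half_notin_Ints: "(1 / 2 :: complex) \<notin> \<int>"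
proof
  assume "(1 / 2 :: complex) \<in> \<int>"
  then obtain n :: int where "(1 / 2 :: complex) = of_int n" by (auto elim: Ints_cases)
  then have "of_int (2 * n) = (of_int 1 :: complex)" by (simp add: mult.commute)
  then have "2 * n = 1" by (simp only: of_int_eq_iff)
  then show False by presburger
qed

lemma miller_paris2_definedI:
  assumes "\<gamma> - \<alpha> \<notin> \<int>" "\<gamma> - \<beta> \<notin> \<int>"
  shows "miller_paris2_defined N \<alpha> \<beta> \<gamma>"
  using assms unfolding miller_paris2_defined_def
  by (auto intro!: pochhammer_nonzero_if_notin_Ints)

text \<open>For the outermost operator \<gamma> - \<beta> is 1/2 and never an integer; its other
  denominators are covered by the condition on \<open>c + k / 2\<close>.\<close>

lemma R_definedI:
  assumes f: "(\<Prod>j=1..r. pochhammer (f j) (m j)) \<noteq> 0"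
    and bc: "Im (b + c + k / 2) \<noteq> 0" "Im (c + k / 2) \<noteq> 0"
    and last: "miller_paris2_defined (partial_sum m r) (1 / 2 - k - of_nat (partial_sum m r) - c - b)
        (f r + k / 2 - of_nat (partial_sum m (r - 1))) (1 - k / 2)"
    and chain: "\<And>s. s \<in> {2..r} \<Longrightarrow> miller_paris2_defined (partial_sum m (s - 1)) (1 - k - f s)
        (f (s - 1) + k / 2 - of_nat (partial_sum m (s - 2))) (1 - k / 2)"
  shows "R_defined b c r f m k"
proof -
  have "1 - k / 2 - (1 / 2 - k / 2) = 1 / 2" by (simp add: field_simps)
  then have "1 - k / 2 - (1 / 2 - k / 2) \<notin> \<int>"
    by (metis half_notin_Ints)
  moreover have "1 - k / 2 - c \<notin> \<int>"
    using bc(2) by (intro Im_nonzero_notin_Ints) simp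
  ultimately have "miller_paris2_defined (partial_sum m r) c (1 / 2 - k / 2) (1 - k / 2)"
    by (intro miller_paris2_definedI)
  moreover have "pochhammer (c + b + k / 2) (partial_sum m r) \<noteq> 0"
    using bc(1) by (intro pochhammer_nonzero_if_notin_Ints Im_nonzero_notin_Ints) (simp add: algebra_simps)
  ultimately show ?thesis
    using f last chain by (auto simp: R_defined_def Let_def)
qed

section \<open>A product sum with two terminating parameters\<close>

text \<open>
  The identity is transported from the points $k = \mathrm{i} y$, with $y$ a large natural number, where no factor
  of the generic computation vanishes because its imaginary part does not.
\<close>

lemma terminating_product_sum:
  fixes c :: complex and f :: "nat \<Rightarrow> complex" and m :: "nat \<Rightarrow> nat" and r v k :: nat
  defines "M \<equiv> partial_sum m r" and "d \<equiv> 1 / 2 + c - of_nat v + of_nat (partial_sum m r)"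
  assumes r: "r \<ge> 1" and c: "Im c \<noteq> 0" and kv: "k \<le> v"
    and f: "\<And>j. j \<in> {1..r} \<Longrightarrow> f j \<notin> \<int>\<^sub>\<le>\<^sub>0"
    and dfd: "R_defined (- of_nat v) c r f m (of_nat k)"
  shows "(\<Sum>j\<le>v. pochhammer (- of_nat k) j * pochhammer (- of_nat v) j * pochhammer c j * pochhammer (1 - of_nat k - d) j *
              sym_prod f m (of_nat k) r j /
            (fact j * pochhammer (1 - of_nat k + of_nat v) j * pochhammer (1 - of_nat k - c) j * pochhammer d j)) =
         4 ^ v * pochhammer (1 / 2 - of_nat k / 2 - c) v * pochhammer (1 - of_nat k / 2 - c - of_nat M) v *
           pochhammer (1 / 2 - of_nat M) v * poly (R_hat (- of_nat v) c r f m (of_nat k)) (of_nat v) /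
         (pochhammer (1 - of_nat k + of_nat v) v * pochhammer (1 - of_nat k - c) v * pochhammer (1 / 2 - c - of_nat M) v)"
proof -
  define D where "D = {k. R_defined (- of_nat v) c r f m k \<and> pochhammer (1 - k + of_nat v) v \<noteq> 0 \<and>
     pochhammer (1 - k - c) v \<noteq> 0 \<and> (\<forall>t\<in>{1..r}. pochhammer (f t + k) (m t) \<noteq> 0)}"
  define L where "L k = (\<Sum>j\<le>v. pochhammer (- k) j * pochhammer (- of_nat v) j * pochhammer c j * pochhammer (1 - k - d) j *
              sym_prod f m k r j /
            (fact j * pochhammer (1 - k + of_nat v) j * pochhammer (1 - k - c) j * pochhammer d j))" for k
  define R where "R k = 4 ^ v * pochhammer (1 / 2 - k / 2 - c) v * pochhammer (1 - k / 2 - c - of_nat M) v *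
           pochhammer (1 / 2 - of_nat M) v * poly (R_hat (- of_nat v) c r f m k) (of_nat v) /
         (pochhammer (1 - k + of_nat v) v * pochhammer (1 - k - c) v * pochhammer (1 / 2 - c - of_nat M) v)" for k
  have d_nz: "pochhammer d j \<noteq> 0" for j
    using c by (intro pochhammer_nonzero_if_notin_Ints Im_nonzero_notin_Ints) (simp add: d_def)
  have c_nz: "pochhammer (1 / 2 - c - of_nat M) j \<noteq> 0" for j
    using c by (intro pochhammer_nonzero_if_notin_Ints Im_nonzero_notin_Ints) simp
  have half: "ratfun_on D (\<lambda>k. k / 2)"
    by (intro ratfun_on_divide ratfun_on_intros) simp
  have nz_le: "pochhammer (1 - k + of_nat v) j \<noteq> 0" "pochhammer (1 - k - c) j \<noteq> 0" if "k \<in> D" "j \<le> v" for k j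
  proof -
    have nz: "pochhammer (1 - k + of_nat v) v \<noteq> 0" "pochhammer (1 - k - c) v \<noteq> 0"
      using that(1) by (simp_all add: D_def)
    show "pochhammer (1 - k + of_nat v) j \<noteq> 0" "pochhammer (1 - k - c) j \<noteq> 0"
      by (rule pochhammer_neq_0_mono[OF nz(1) that(2)], rule pochhammer_neq_0_mono[OF nz(2) that(2)])
  qed
  have D: "R_defined (- of_nat v) c r f m k" "t \<in> {1..r} \<Longrightarrow> pochhammer (f t + k) (m t) \<noteq> 0" if "k \<in> D" for k t
    using that by (simp_all add: D_def)
  have ratL: "ratfun_on D L"
    unfolding L_def sym_prod_def
    by (intro ratfun_on_divide ratfun_on_intros) (simp_all add: nz_le d_nz D)
  have ratR: "ratfun_on D R"
    unfolding R_def
    by (intro ratfun_on_divide ratfun_on_R_hat ratfun_on_intros half) (simp_all add: nz_le c_nz D)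
  \<comment> \<open>A common bound for the imaginary parts of \<open>c\<close> and the
    \<open>f t\<close>. Twice this bound is required of y because the parameters contain k/2, whose
    imaginary part y/2 has to dominate them.\<close>
  define B where "B = Max (insert \<bar>Im c\<bar> ((\<lambda>t. \<bar>Im (f t)\<bar>) ` {1..r}))"
  have B: "\<bar>Im c\<bar> \<le> B" "t \<in> {1..r} \<Longrightarrow> \<bar>Im (f t)\<bar> \<le> B" for t
    unfolding B_def by (rule Max_ge; force)+
  define A where "A = (\<lambda>y. \<i> * of_nat y) ` {y::nat. real y > 2 * B}"
  have "infinite {y::nat. real y > 2 * B}"
  proof -
    have "{nat \<lceil>2 * B\<rceil> + 1..} \<subseteq> {y::nat. real y > 2 * B}"
      by (auto simp: nat_le_iff ceiling_le_iff Suc_le_eq) linarith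
    then show ?thesis using infinite_Ici infinite_super by blast
  qed
  then have "infinite A"
    unfolding A_def by (subst finite_image_iff) (auto simp: inj_on_def)
  have sub: "A \<subseteq> D" and eq: "\<And>k. k \<in> A \<Longrightarrow> L k = R k"
  proof -
    have fprod: "(\<Prod>j=1..r. pochhammer (f j) (m j)) \<noteq> 0"
      using dfd by (simp add: R_defined_def Let_def)
    have "k \<in> D \<and> L k = R k" if "k \<in> A" for k
    proof -
      obtain y :: nat where y: "k = \<i> * of_nat y" "real y > 2 * B"
        using \<open>k \<in> A\<close> by (auto simp: A_def)
      have Imk: "Im k = real y" by (simp add: y)
      have Imf: "2 * \<bar>Im (f t)\<bar> < real y" if "t \<in> {1..r}" for t
        using B(2)[OF that] y(2) by linarith
      have Imc: "2 * \<bar>Im c\<bar> < real y"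
        using B(1) y(2) by linarith
      have step: "miller_paris2_defined N \<alpha> (f t + k / 2 - of_nat n) (1 - k / 2)"
        if "t \<in> {1..r}" "Im k / 2 + Im \<alpha> \<noteq> 0" for N \<alpha> t n
        using Imf[OF that(1)] Imk that(2)
        by (intro miller_paris2_definedI Im_nonzero_notin_Ints) auto
      define p where "p = 1 - k - f r - of_nat (m r)"
      \<comment> \<open>This is 1 + a - d for a = -k, and at the same time the first parameter of
        the inner operator in \<open>R_hat\<close> for b = -v.\<close>
      define p' where "p' = 1 - k - d"
      have p'_eq: "1 / 2 - k - of_nat (partial_sum m r) - c - - of_nat v = p'"
        by (simp add: p'_def d_def)
      have last: "miller_paris2_defined M p' (f r + k / 2 - of_nat (partial_sum m (r - 1))) (1 - k / 2)"
        using r Imk Imc by (intro step) (auto simp: p'_def d_def)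
      have chain: "miller_paris2_defined (partial_sum m (s - 1)) (1 - k - f s)
          (f (s - 1) + k / 2 - of_nat (partial_sum m (s - 2))) (1 - k / 2)" if "s \<in> {2..r}" for s
        using that Imk Imf[of s] by (intro step) auto
      have Rd: "R_defined (- of_nat v) c r f m k"
      proof (rule R_definedI[OF fprod _ _ _ chain])
        show "miller_paris2_defined (partial_sum m r) (1 / 2 - k - of_nat (partial_sum m r) - c - - of_nat v)
            (f r + k / 2 - of_nat (partial_sum m (r - 1))) (1 - k / 2)"
          using last by (simp only: p'_eq M_def)
      qed (use Imk Imc in auto)
      have nz_ft: "pochhammer (f t + k) n \<noteq> 0" "pochhammer (1 - k - f t - of_nat n') n \<noteq> 0"
        if "t \<in> {1..r}" for t n n'
        using Imf[OF that] Imk by (auto intro!: pochhammer_nonzero_if_notin_Ints Im_nonzero_notin_Ints)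
      have kD: "k \<in> D"
        using Rd nz_ft Imk Imc B by (auto simp: D_def intro!: pochhammer_nonzero_if_notin_Ints Im_nonzero_notin_Ints)
      define G where "G = G_poly f m k r"
      define G' where "G' = miller_paris2 M p' (1 - k / 2 - p - of_nat M) (1 - k / 2) G"
      have M: "M = partial_sum m (r - 1) + m r"
        using r by (cases r) (simp_all add: M_def partial_sum_def)
      have b: "f r + k / 2 - of_nat (partial_sum m (r - 1)) = 1 - k / 2 - p - of_nat M"
        by (simp add: p_def M field_simps)
      have wpG: "degree G \<le> M \<and> wp_sum k p M G j = pochhammer p j * pochhammer (- k / 2) j * sym_prod f m k r j" for j
        unfolding G_def M_def p_def by (rule wp_sum_G_poly[OF r nz_ft(1) nz_ft(2) chain])
      have wpG': "wp_sum k p' M G' j = pochhammer p' j * pochhammer (- k / 2) j * sym_prod f m k r j" for j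
      proof -
        have "pochhammer p j * wp_sum k p' M G' j = pochhammer p' j * wp_sum k p M G j"
          unfolding G'_def using wpG last[unfolded b] by (intro wp_sum_miller_paris2) auto
        moreover have "pochhammer p j \<noteq> 0"
          using r nz_ft(2)[of r] by (simp add: p_def)
        ultimately show ?thesis
          using wpG[of j] by simp
      qed
      have Rhat: "R_hat (- of_nat v) c r f m k = miller_paris2 M c (1 / 2 - k / 2) (1 - k / 2) G'"
        unfolding R_hat_def Let_def G'_def G_def M_def[symmetric] b
        using p'_eq by (simp add: M_def)
      have nz: "pochhammer (- k / 2) v \<noteq> 0" "pochhammer (1 - k / 2) v \<noteq> 0" "pochhammer (1 / 2 - k / 2) v \<noteq> 0"
          "pochhammer (1 - k + of_nat v) v \<noteq> 0" "pochhammer (1 - k - c) v \<noteq> 0" "- k \<noteq> 0"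
        using Imk Imc kD by (auto simp: D_def intro!: pochhammer_nonzero_if_notin_Ints Im_nonzero_notin_Ints)
      have d_eq: "d = 1 / 2 + c - of_nat v + of_nat M"
        by (simp add: d_def M_def)
      have degG': "degree G' \<le> M"
        unfolding G'_def by (rule degree_miller_paris2)
      have conv: "1 / 2 + - k / 2 = 1 / 2 - k / 2" "1 + - k / 2 = 1 - k / 2" "1 + - k = 1 - k" "- (- k) = k"
        by simp_all
      note gen = terminating_product_sum_generic[of d c v M G' "- k" "sym_prod f m k r", unfolded conv]
      have Lk: "L k = pochhammer (1 - k) v * pochhammer (1 / 2 - k / 2 - c) v *
           (pochhammer (1 - k / 2 - c - of_nat M) v * pochhammer (1 / 2 - of_nat M) v *
            poly (miller_paris2 M c (1 / 2 - k / 2) (1 - k / 2) G') (of_nat v)) /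
         (pochhammer (1 - k - c) v * pochhammer (1 / 2 - k / 2) v * pochhammer (1 - k / 2) v *
           pochhammer (1 / 2 - c - of_nat M) v)"
        unfolding L_def
      proof (rule gen)
        show "d = 1 / 2 + c - of_nat v + of_nat M" by (rule d_eq)
        show "degree G' \<le> M" by (rule degG')
        show "miller_paris2_defined M c (1 / 2 - k / 2) (1 - k / 2)"
          using Rd by (simp add: R_defined_def Let_def M_def)
        show "wp_sum k (1 - k - d) M G' j = pochhammer (1 - k - d) j * pochhammer (- k / 2) j * sym_prod f m k r j" for j
          using wpG'[of j] unfolding p'_def .
      qed (fact nz d_nz)+
      \<comment> \<open>The duplication formula removes the obstacle at the target: for natural k
        with 1 \<le> k \<le> v both (1-k)_v and (1/2-k/2)_v (1-k/2)_v are zero, whereas their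
        quotient, written as 4^v / (1-k+v)_v, has no pole there.\<close>
      have "pochhammer (1 - k) v * pochhammer (1 - k + of_nat v) v =
          4 ^ v * pochhammer (1 / 2 - k / 2) v * pochhammer (1 - k / 2) v"
      proof -
        have "pochhammer (1 - k) v * pochhammer (1 - k + of_nat v) v = pochhammer (1 - k) (2 * v)"
          by (simp only: mult_2 pochhammer_product')
        moreover have e: "2 * (1 / 2 - k / 2) = 1 - k" "1 / 2 - k / 2 + 1 / 2 = 1 - k / 2"
          by (simp_all add: right_diff_distrib)
        have "pochhammer (1 - k) (2 * v) = of_nat (2 ^ (2 * v)) * pochhammer (1 / 2 - k / 2) v * pochhammer (1 - k / 2) v"
          using pochhammer_double[of "1 / 2 - k / 2" v] unfolding e .
        ultimately show ?thesis
          by (simp add: power_mult)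
      qed
      then have q: "pochhammer (1 - k) v / (pochhammer (1 / 2 - k / 2) v * pochhammer (1 - k / 2) v) =
          4 ^ v / pochhammer (1 - k + of_nat v) v"
        using nz by (simp add: frac_eq_eq mult.assoc)
      have "L k = (pochhammer (1 - k) v / (pochhammer (1 / 2 - k / 2) v * pochhammer (1 - k / 2) v)) *
          pochhammer (1 / 2 - k / 2 - c) v *
           (pochhammer (1 - k / 2 - c - of_nat M) v * pochhammer (1 / 2 - of_nat M) v *
            poly (R_hat (- of_nat v) c r f m k) (of_nat v)) /
         (pochhammer (1 - k - c) v * pochhammer (1 / 2 - c - of_nat M) v)"
        unfolding Rhat Lk by (simp add: mult_ac)
      also have "\<dots> = R k"
        unfolding q R_def by (simp add: mult_ac)
      finally show ?thesis using kD by blast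
    qed
    then show "A \<subseteq> D" "\<And>k. k \<in> A \<Longrightarrow> L k = R k" by auto
  qed
  \<comment> \<open>Here k \<le> v matters: it makes 1 - k + v a positive integer.\<close>
  have "of_nat k \<in> D"
  proof -
    have "1 - of_nat k + of_nat v = (of_nat (Suc (v - k)) :: complex)"
      using kv by (simp add: of_nat_diff)
    then have "pochhammer (1 - of_nat k + of_nat v :: complex) v \<noteq> 0"
      by (simp only: pochhammer_of_nat) (simp add: pochhammer_pos less_imp_neq[THEN not_sym] del: of_nat_Suc)
    moreover have "pochhammer (1 - of_nat k - c) v \<noteq> 0"
      using c by (intro pochhammer_nonzero_if_notin_Ints Im_nonzero_notin_Ints) simp
    moreover have "pochhammer (f t + of_nat k) (m t) \<noteq> 0" if "t \<in> {1..r}" for t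
    proof
      assume "pochhammer (f t + of_nat k) (m t) = 0"
      then obtain i where "f t + of_nat k = - of_nat i"
        by (auto simp: pochhammer_eq_0_iff)
      then have "f t = - of_nat i - of_nat k"
        by (simp only: eq_diff_eq)
      then have "f t = - of_nat (k + i)"
        by simp
      then show False
        using f[OF that] by (metis minus_of_nat_in_nonpos_Ints)
    qed
    ultimately show ?thesis using dfd by (auto simp: D_def)
  qed
  have "L (of_nat k) = R (of_nat k)"
    by (rule ratfun_on_identity[OF ratL ratR \<open>infinite A\<close> sub _ \<open>of_nat k \<in> D\<close>]) (rule eq)
  then show ?thesis
    by (simp only: L_def R_def)
qed

text \<open>Trades a shift by \<open>M\<close> in a symbol of length \<open>v\<close> for symbols of
  length \<open>M\<close> at \<open>z\<close> and \<open>z - of_nat v\<close>. For b = -v the latter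
  is z + b, which is how the symbols in b + 1/2 and c + b of the final formula arise.\<close>

lemma pochhammer_shift_quotient:
  fixes z :: "'a::field_char_0"
  assumes "pochhammer (z - of_nat v) M \<noteq> 0"
  shows "pochhammer (1 - z - of_nat M) v = pochhammer z M * pochhammer (1 - z) v / pochhammer (z - of_nat v) M"
proof -
  have "pochhammer (1 - z - of_nat M) M * pochhammer (1 - z) v =
        pochhammer (1 - z - of_nat M) v * pochhammer (1 - (z - of_nat v) - of_nat M) M"
    using pochhammer_shift_swap[of "1 - z - of_nat M" M v] by (simp add: algebra_simps)
  then have "(-1) ^ M * ((-1) ^ M * pochhammer z M * pochhammer (1 - z) v) =
    (-1) ^ M * (pochhammer (1 - z - of_nat M) v * ((-1) ^ M * pochhammer (z - of_nat v) M))"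
    unfolding pochhammer_reflect by simp
  then show ?thesis
    using assms by (simp add: field_simps)
qed

text \<open>The constant for M = 0: the right side belongs to the coefficient in Clausen's formula
  for the square of 2F1(b, c; b + c + 1/2; x). Duplication joins the symbols with halves, and the
  shift rule moves \<open>k\<close> from the argument of a symbol into its length.\<close>

lemma clausen_constant:
  fixes c :: complex
  assumes c: "Im c \<noteq> 0" and kv: "k \<le> v"
  defines "b \<equiv> - of_nat v :: complex"
  shows "pochhammer b k * pochhammer c k *
           (4 ^ v * pochhammer (1 / 2 - of_nat k / 2 - c) v * pochhammer (1 - of_nat k / 2 - c) v * pochhammer (1 / 2) v /
            (pochhammer (1 - of_nat k + of_nat v) v * pochhammer (1 - of_nat k - c) v * pochhammer (1 / 2 - c) v)) =
         pochhammer (2 * b) k * pochhammer (2 * c) k * pochhammer (c + b) k / pochhammer (2 * c + 2 * b) k"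
proof -
  have nz: "pochhammer (c + of_nat i - of_nat j) n \<noteq> 0" "pochhammer (2 * c - of_nat j) n \<noteq> 0" "pochhammer (x - c) n \<noteq> 0"
    "pochhammer (y - 2 * c) n \<noteq> 0"
    if "Im x = 0" "Im y = 0" for i j n x y
    using c that by (auto intro!: pochhammer_nonzero_if_notin_Ints Im_nonzero_notin_Ints)
  have dbl: "4 ^ v * pochhammer x v * pochhammer (x + 1 / 2) v = pochhammer (2 * x) (2 * v)" for x :: complex
    unfolding pochhammer_double by (simp add: power_mult)
  have 1: "4 ^ v * pochhammer (1 / 2 - of_nat k / 2 - c) v * pochhammer (1 - of_nat k / 2 - c) v =
      pochhammer (2 * c) k * pochhammer (1 - 2 * c) (2 * v) / pochhammer (2 * c + 2 * b) k"
  proof -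
    have e: "1 / 2 - of_nat k / 2 - c + 1 / 2 = 1 - of_nat k / 2 - c" "2 * (1 / 2 - of_nat k / 2 - c) = 1 - 2 * c - of_nat k"
      by (simp_all add: field_simps)
    have "4 ^ v * pochhammer (1 / 2 - of_nat k / 2 - c) v * pochhammer (1 - of_nat k / 2 - c) v =
        pochhammer (1 - 2 * c - of_nat k) (2 * v)"
      using dbl[of "1 / 2 - of_nat k / 2 - c"] unfolding e .
    moreover have "2 * c + 2 * b = 2 * c - of_nat (2 * v)" by (simp add: b_def)
    moreover have "pochhammer (1 - 2 * c - of_nat k) (2 * v) =
        pochhammer (2 * c) k * pochhammer (1 - 2 * c) (2 * v) / pochhammer (2 * c - of_nat (2 * v)) k"
      by (rule pochhammer_shift_quotient, rule nz(2)[of 0 0]) simp_all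
    ultimately show ?thesis
      by (simp only:)
  qed
  have 2: "4 ^ v * pochhammer (1 / 2 - c) v * pochhammer (1 - c) v = pochhammer (1 - 2 * c) (2 * v)"
  proof -
    have e: "1 / 2 - c + 1 / 2 = 1 - c" "2 * (1 / 2 - c) = 1 - 2 * c"
      by (simp_all add: field_simps)
    show ?thesis
      using dbl[of "1 / 2 - c"] unfolding e .
  qed
  have 3: "pochhammer (1 - of_nat k - c) v = pochhammer c k * pochhammer (1 - c) v / pochhammer (c + b) k"
  proof -
    have "pochhammer (c - of_nat v) k \<noteq> 0" using nz(1)[of 0 0 0 v k] by simp
    then have "pochhammer (1 - c - of_nat k) v = pochhammer c k * pochhammer (1 - c) v / pochhammer (c - of_nat v) k"
      by (rule pochhammer_shift_quotient)
    moreover have "1 - of_nat k - c = 1 - c - of_nat k" "c + b = c - of_nat v" by (simp_all add: b_def)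
    ultimately show ?thesis by (simp only:)
  qed
  have b_nz: "pochhammer b k \<noteq> 0" "pochhammer (2 * b) k \<noteq> 0"
    using kv pochhammer_of_nat_eq_0_iff[of v k, where 'a=complex] pochhammer_of_nat_eq_0_iff[of "2 * v" k, where 'a=complex]
    by (auto simp: b_def)
  have h_nz: "pochhammer (1 / 2) v \<noteq> (0 :: complex)"
    by (rule pochhammer_nonzero_if_notin_Ints[OF half_notin_Ints])
  have 4: "pochhammer (1 - of_nat k + of_nat v) v = pochhammer b k * (4 ^ v * pochhammer (1 / 2) v) / pochhammer (2 * b) k"
  proof -
    have "4 ^ v * pochhammer (1 / 2) v * pochhammer 1 v = (pochhammer 1 (v + v) :: complex)"
      using dbl[of "1 / 2"] by (simp add: mult_2)
    also have "\<dots> = pochhammer 1 v * pochhammer (1 + of_nat v) v"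
      by (rule pochhammer_product')
    finally have "pochhammer (1 + of_nat v) v = (4 ^ v * pochhammer (1 / 2) v :: complex)"
      by (simp flip: pochhammer_fact)
    moreover have "pochhammer (b - of_nat v) k \<noteq> 0"
      using b_nz(2) by (simp add: b_def)
    then have "pochhammer (1 - b - of_nat k) v = pochhammer b k * pochhammer (1 - b) v / pochhammer (b - of_nat v) k"
      by (rule pochhammer_shift_quotient)
    moreover have "1 - b - of_nat k = 1 - of_nat k + of_nat v" "1 - b = 1 + of_nat v" "b - of_nat v = 2 * b"
      by (simp_all add: b_def)
    ultimately show ?thesis by (simp only:)
  qed
  have "pochhammer (1 / 2 - c) v \<noteq> 0" "pochhammer (1 - c) v \<noteq> 0" "pochhammer (c + b) k \<noteq> 0" "pochhammer c k \<noteq> 0"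
    using nz(3)[of "1 / 2" 0 v] nz(3)[of 1 0 v] nz(1)[of 0 0 0 v k] nz(1)[of 0 0 0 0 k] by (simp_all add: b_def)
  then show ?thesis
    using b_nz h_nz unfolding 1 2[symmetric] 3 4 by simp
qed

section \<open>The product formula\<close>

lemma pochhammer_reverse:
  fixes x :: "'a::comm_ring_1"
  assumes "j \<le> k"
  shows "pochhammer x (k - j) * pochhammer (1 - of_nat k - x) j = (-1) ^ j * pochhammer x k"
proof -
  have e: "1 - of_nat k - x = 1 - (x + of_nat (k - j)) - of_nat j"
    using assms by (simp add: of_nat_diff)
  have "pochhammer x k = pochhammer x (k - j) * pochhammer (x + of_nat (k - j)) j"
    using pochhammer_product'[of x "k - j" j] assms by simp
  then show ?thesis
    unfolding e pochhammer_reflect by (simp add: mult.left_commute)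
qed

lemma lhs_series_nth:
  "fps_nth (lhs_series b c r f m) j =
     pochhammer b j * pochhammer c j / (pochhammer (1 / 2 + c + b + of_nat (partial_sum m r)) j * fact j) *
     ((\<Prod>t=1..r. pochhammer (f t + of_nat (m t)) j) / (\<Prod>t=1..r. pochhammer (f t) j))"
  by (simp add: lhs_series_def mult_ac)

text \<open>Reversal replaces a symbol (x)_(k-j) by a signed constant divided by (1-k-x)_j, which
  makes the summand well-poised with a = -k; everything independent of \<open>j\<close> goes into
  the prefactor.\<close>

lemma lhs_series_product_term:
  fixes b c :: complex and f :: "nat \<Rightarrow> complex" and m :: "nat \<Rightarrow> nat" and r :: nat
  defines "d \<equiv> 1 / 2 + c + b + of_nat (partial_sum m r)"
  assumes j: "j \<le> k"
    and nz: "pochhammer (1 - of_nat k - b) j \<noteq> 0" "pochhammer (1 - of_nat k - c) j \<noteq> 0" "pochhammer d k \<noteq> 0"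
    and f: "\<And>t n. t \<in> {1..r} \<Longrightarrow> pochhammer (f t) n \<noteq> 0"
  shows "fps_nth (lhs_series b c r f m) j * fps_nth (lhs_series b c r f m) (k - j) =
    pochhammer b k * pochhammer c k / (pochhammer d k * fact k) *
    ((\<Prod>t=1..r. pochhammer (f t + of_nat k) (m t)) / (\<Prod>t=1..r. pochhammer (f t) (m t))\<^sup>2) *
    (pochhammer (- of_nat k) j * pochhammer b j * pochhammer c j * pochhammer (1 - of_nat k - d) j * sym_prod f m (of_nat k) r j /
      (fact j * pochhammer (1 - of_nat k - b) j * pochhammer (1 - of_nat k - c) j * pochhammer d j))"
proof -
  \<comment> \<open>Both quotients are (f)_(m+n) / ((f)_m (f)_n); the right form has symbols of
    fixed length, polynomial in \<open>n\<close>.\<close>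
  have ratio: "(\<Prod>t=1..r. pochhammer (f t + of_nat (m t)) n) / (\<Prod>t=1..r. pochhammer (f t) n) =
      (\<Prod>t=1..r. pochhammer (f t + of_nat n) (m t)) / (\<Prod>t=1..r. pochhammer (f t) (m t))" for n
    unfolding prod_dividef[symmetric]
  proof (intro prod.cong refl)
    fix t assume t: "t \<in> {1..r}"
    show "pochhammer (f t + of_nat (m t)) n / pochhammer (f t) n = pochhammer (f t + of_nat n) (m t) / pochhammer (f t) (m t)"
      using f[OF t] pochhammer_shift_swap[of "f t" "m t" n] by (simp add: frac_eq_eq mult_ac)
  qed
  have fk: "pochhammer (f t + of_nat k) (m t) \<noteq> 0" if "t \<in> {1..r}" for t
    using f[OF that, of "k + m t"] by (simp add: pochhammer_product')
  have sym: "(\<Prod>t=1..r. pochhammer (f t + of_nat j) (m t)) * (\<Prod>t=1..r. pochhammer (f t + of_nat (k - j)) (m t)) =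
      (\<Prod>t=1..r. pochhammer (f t + of_nat k) (m t)) * sym_prod f m (of_nat k) r j"
    unfolding sym_prod_def prod.distrib[symmetric]
    using fk j by (intro prod.cong refl) (simp add: of_nat_diff add_diff_eq)
  have rev: "pochhammer x (k - j) = (-1) ^ j * pochhammer x k / pochhammer (1 - of_nat k - x) j"
    if "pochhammer (1 - of_nat k - x) j \<noteq> 0" for x :: complex
    using pochhammer_reverse[OF j, of x] that by (simp add: field_simps)
  have dk: "pochhammer d k \<noteq> 0" "pochhammer d (k - j) \<noteq> 0"
    using nz(3) pochhammer_neq_0_mono[OF nz(3), of "k - j"] by auto
  have d: "inverse (pochhammer d (k - j)) = (-1) ^ j * pochhammer (1 - of_nat k - d) j / pochhammer d k"
  proof -
    have "(-1) ^ j * (pochhammer d (k - j) * pochhammer (1 - of_nat k - d) j) = pochhammer d k"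
      unfolding pochhammer_reverse[OF j] by simp
    then have "pochhammer d (k - j) * ((-1) ^ j * pochhammer (1 - of_nat k - d) j / pochhammer d k) = 1"
      using dk by (simp add: mult_ac)
    then show ?thesis
      using dk by (metis inverse_unique)
  qed
  have fct: "inverse (fact (k - j)) = (-1) ^ j * pochhammer (- of_nat k) j / (fact k :: complex)"
    unfolding pochhammer_minus_of_nat using binomial_fact[OF j, where 'a=complex] by (simp add: field_simps)
  have "fps_nth (lhs_series b c r f m) j * fps_nth (lhs_series b c r f m) (k - j) =
     (pochhammer b (k - j) * pochhammer c (k - j) * inverse (pochhammer d (k - j)) * inverse (fact (k - j))) *
     (pochhammer b j * pochhammer c j / (pochhammer d j * fact j)) *
     (((\<Prod>t=1..r. pochhammer (f t + of_nat j) (m t)) * (\<Prod>t=1..r. pochhammer (f t + of_nat (k - j)) (m t))) /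
       (\<Prod>t=1..r. pochhammer (f t) (m t))\<^sup>2)"
    unfolding lhs_series_nth d_def[symmetric] ratio by (simp add: divide_inverse power2_eq_square mult_ac)
  also have "pochhammer b (k - j) * pochhammer c (k - j) * inverse (pochhammer d (k - j)) * inverse (fact (k - j)) =
     pochhammer b k * pochhammer c k / (pochhammer d k * fact k) *
      (pochhammer (- of_nat k) j * pochhammer (1 - of_nat k - d) j / (pochhammer (1 - of_nat k - b) j * pochhammer (1 - of_nat k - c) j))"
    unfolding rev[OF nz(1)] rev[OF nz(2)] d fct by (simp add: mult_ac)
  finally show ?thesis
    unfolding sym by (simp add: mult_ac)
qed

lemma lhs_series_square_nth_nonpos_int:
  fixes c :: complex and f :: "nat \<Rightarrow> complex" and m :: "nat \<Rightarrow> nat" and r v k :: nat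
  defines "b \<equiv> - of_nat v :: complex"
  assumes r: "r \<ge> 1" and c: "Im c \<noteq> 0" and kv: "k \<le> v"
    and f: "\<And>j. j \<in> {1..r} \<Longrightarrow> f j \<notin> \<int>\<^sub>\<le>\<^sub>0"
    and dfd: "R_defined b c r f m (of_nat k)"
  shows "(\<Sum>j=0..k. fps_nth (lhs_series b c r f m) j * fps_nth (lhs_series b c r f m) (k - j)) =
    rhs_prefactor b c (partial_sum m r) * fps_nth (rhs_series b c r f m) k"
proof -
  define M where "M = partial_sum m r"
  define d where "d = 1 / 2 + c + b + of_nat M"
  define F where "F = (\<Prod>t=1..r. pochhammer (f t + of_nat k) (m t)) / (\<Prod>t=1..r. pochhammer (f t) (m t))\<^sup>2"
  define K where "K = pochhammer b k * pochhammer c k / (pochhammer d k * fact k) * F"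
  define T where "T j = pochhammer (- of_nat k) j * pochhammer b j * pochhammer c j * pochhammer (1 - of_nat k - d) j * sym_prod f m (of_nat k) r j /
      (fact j * pochhammer (1 - of_nat k - b) j * pochhammer (1 - of_nat k - c) j * pochhammer d j)" for j
  have f_nz: "pochhammer (f t) n \<noteq> 0" if "t \<in> {1..r}" for t n
    using f[OF that] by (auto simp: pochhammer_eq_0_iff)
  have c_nz: "pochhammer (x - c) n \<noteq> 0" "pochhammer (c + x) n \<noteq> 0" if "Im x = 0" for x n
    using c that by (auto intro!: pochhammer_nonzero_if_notin_Ints Im_nonzero_notin_Ints)
  have half_nz: "pochhammer (1 / 2 - of_nat i) n \<noteq> (0 :: complex)" for i n
    by (rule pochhammer_nonzero_if_notin_Ints) (use half_notin_Ints in \<open>auto simp del: of_nat_diff\<close>)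
  have d_nz: "pochhammer d n \<noteq> 0" for n
    using c_nz(2)[of "1 / 2 + b + of_nat M" n] by (simp add: d_def b_def add_ac)
  have b_nz: "pochhammer (1 - of_nat k - b) j \<noteq> 0" for j
  proof -
    have "1 - of_nat k - b = of_nat (Suc (v - k))"
      using kv by (simp add: of_nat_diff b_def)
    then show ?thesis
      by (simp only: pochhammer_of_nat) (simp add: pochhammer_pos less_imp_neq[THEN not_sym] del: of_nat_Suc)
  qed
  have "(\<Sum>j=0..k. fps_nth (lhs_series b c r f m) j * fps_nth (lhs_series b c r f m) (k - j)) = (\<Sum>j\<le>k. K * T j)"
    unfolding atLeast0AtMost
  proof (intro sum.cong refl)
    fix j assume "j \<in> {..k}"
    then have j: "j \<le> k" by simp
    show "fps_nth (lhs_series b c r f m) j * fps_nth (lhs_series b c r f m) (k - j) = K * T j"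
      unfolding K_def F_def T_def d_def M_def
      by (rule lhs_series_product_term[OF j b_nz]) (use c_nz(1)[of "1 - of_nat k"] d_nz f_nz in \<open>auto simp: d_def M_def\<close>)
  qed
  \<comment> \<open>The terms with k < j vanish through (-k)_j. The longer range is the one shared
    with generic \<open>a\<close>, where only b = -v terminates the sum.\<close>
  also have "\<dots> = K * (\<Sum>j\<le>v. T j)"
    unfolding sum_distrib_left using kv
    by (intro sum.mono_neutral_left) (auto simp: T_def pochhammer_of_nat_eq_0_lemma)
  also have "(\<Sum>j\<le>v. T j) = 4 ^ v * pochhammer (1 / 2 - of_nat k / 2 - c) v * pochhammer (1 - of_nat k / 2 - c - of_nat M) v *
           pochhammer (1 / 2 - of_nat M) v * poly (R_hat b c r f m (of_nat k)) (- b) /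
         (pochhammer (1 - of_nat k - b) v * pochhammer (1 - of_nat k - c) v * pochhammer (1 / 2 - c - of_nat M) v)"
  proof -
    have e: "1 - of_nat k - b = 1 - of_nat k + of_nat v" "- b = of_nat v"
      "d = 1 / 2 + c - of_nat v + of_nat (partial_sum m r)"
      by (simp_all add: b_def d_def M_def)
    show ?thesis
      unfolding T_def e M_def unfolding b_def
      by (rule terminating_product_sum[OF r c kv f dfd[unfolded b_def]])
  qed
  also have "K * \<dots> = rhs_prefactor b c M * fps_nth (rhs_series b c r f m) k"
  proof -
    \<comment> \<open>The three identities strip the shift by \<open>M\<close>: Clausen's constant
      remains, and the symbols split off are those of \<open>rhs_prefactor\<close> and
      \<open>R_fun\<close>.\<close>
    have 1: "pochhammer (1 - of_nat k / 2 - c - of_nat M) v =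
        pochhammer (c + of_nat k / 2) M * pochhammer (1 - of_nat k / 2 - c) v / pochhammer (c + b + of_nat k / 2) M"
    proof -
      have e: "1 - (c + of_nat k / 2) = 1 - of_nat k / 2 - c" "c + of_nat k / 2 - of_nat v = c + b + of_nat k / 2"
        by (simp_all add: b_def)
      have "pochhammer (c + b + of_nat k / 2) M \<noteq> 0"
        unfolding add.assoc by (rule c_nz) (simp add: b_def)
      then show ?thesis
        using pochhammer_shift_quotient[of "c + of_nat k / 2" v M] unfolding e by simp
    qed
    have 2: "pochhammer (1 / 2 - of_nat M) v = pochhammer (1 / 2) M * pochhammer (1 / 2) v / pochhammer (b + 1 / 2) M"
      using pochhammer_shift_quotient[of "1 / 2 :: complex" v M] half_nz[of v M] by (simp add: b_def)
    have 3: "pochhammer (1 / 2 - c - of_nat M) v =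
        pochhammer (c + 1 / 2) M * pochhammer (1 / 2 - c) v / pochhammer (c + b + 1 / 2) M"
    proof -
      have e: "1 - (c + 1 / 2) = 1 / 2 - c" "c + 1 / 2 - of_nat v = c + b + 1 / 2"
        by (simp_all add: b_def)
      have "pochhammer (c + b + 1 / 2) M \<noteq> 0"
        unfolding add.assoc by (rule c_nz) (simp add: b_def)
      then show ?thesis
        using pochhammer_shift_quotient[of "c + 1 / 2" v M] unfolding e by simp
    qed
    have cl: "pochhammer b k * pochhammer c k *
           (4 ^ v * pochhammer (1 / 2 - of_nat k / 2 - c) v * pochhammer (1 - of_nat k / 2 - c) v * pochhammer (1 / 2) v /
            (pochhammer (1 - of_nat k - b) v * pochhammer (1 - of_nat k - c) v * pochhammer (1 / 2 - c) v)) =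
         pochhammer (2 * b) k * pochhammer (2 * c) k * pochhammer (c + b) k / pochhammer (2 * c + 2 * b) k"
      using clausen_constant[OF c kv] by (simp add: b_def)
    have "K * (4 ^ v * pochhammer (1 / 2 - of_nat k / 2 - c) v * pochhammer (1 - of_nat k / 2 - c - of_nat M) v *
           pochhammer (1 / 2 - of_nat M) v * poly (R_hat b c r f m (of_nat k)) (- b) /
         (pochhammer (1 - of_nat k - b) v * pochhammer (1 - of_nat k - c) v * pochhammer (1 / 2 - c - of_nat M) v)) =
      (pochhammer b k * pochhammer c k *
           (4 ^ v * pochhammer (1 / 2 - of_nat k / 2 - c) v * pochhammer (1 - of_nat k / 2 - c) v * pochhammer (1 / 2) v /
            (pochhammer (1 - of_nat k - b) v * pochhammer (1 - of_nat k - c) v * pochhammer (1 / 2 - c) v))) *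
      (pochhammer (1 / 2) M * pochhammer (c + b + 1 / 2) M / (pochhammer (b + 1 / 2) M * pochhammer (c + 1 / 2) M)) *
      (pochhammer (c + of_nat k / 2) M / pochhammer (c + b + of_nat k / 2) M) *
      (F * poly (R_hat b c r f m (of_nat k)) (- b) / (pochhammer d k * fact k))"
      unfolding 1 2 3 K_def by (simp add: mult_ac)
    also have "\<dots> = rhs_prefactor b c M * fps_nth (rhs_series b c r f m) k"
      unfolding cl rhs_prefactor_def rhs_series_def R_fun_def F_def d_def M_def by (simp add: mult_ac)
    finally show ?thesis .
  qed
  finally show ?thesis by (simp add: M_def)
qed

text \<open>The operators inside \<open>G_poly\<close> contain neither \<open>b\<close> nor
  \<open>c\<close>, and the denominators outside them involve these only through \<open>c\<close>
  and \<open>b + c\<close>; two nonzero imaginary parts therefore secure everything that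
  changes.\<close>

lemma R_defined_change_bc:
  assumes "R_defined b c r f m k" "Im (b' + c' + k / 2) \<noteq> 0" "Im (c' + k / 2) \<noteq> 0"
  shows "R_defined b' c' r f m k"
proof (rule R_definedI)
  show "miller_paris2_defined (partial_sum m r) (1 / 2 - k - of_nat (partial_sum m r) - c' - b')
        (f r + k / 2 - of_nat (partial_sum m (r - 1))) (1 - k / 2)"
  proof -
    have "pochhammer (1 - k / 2 - (1 / 2 - k - of_nat (partial_sum m r) - c' - b') - of_nat (partial_sum m r) + of_nat i) n \<noteq> 0"
      for i n using assms(2) by (intro pochhammer_nonzero_if_notin_Ints Im_nonzero_notin_Ints) (simp add: algebra_simps)
    from this[of 0] this show ?thesis
      using assms(1) unfolding R_defined_def Let_def miller_paris2_defined_def by simp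
  qed
qed (use assms in \<open>auto simp: R_defined_def Let_def\<close>)

text \<open>
  Moving $c$ along with $b$ on a complex line makes $c$ non-real at almost all points $b = -v$, which keeps all
  denominators containing $c$ away from zero.
\<close>

lemma lhs_series_square_nth:
  fixes b c :: complex and f :: "nat \<Rightarrow> complex" and m :: "nat \<Rightarrow> nat" and r k :: nat
  assumes r: "r \<ge> 1"
    and f: "\<And>j. j \<in> {1..r} \<Longrightarrow> f j \<notin> \<int>\<^sub>\<le>\<^sub>0"
    and dfd: "both_sides_defined b c r f m"
  shows "(\<Sum>j=0..k. fps_nth (lhs_series b c r f m) j * fps_nth (lhs_series b c r f m) (k - j)) =
    rhs_prefactor b c (partial_sum m r) * fps_nth (rhs_series b c r f m) k"
proof -
  \<comment> \<open>The line passes through the given pair, as \<open>c' b = c\<close>. The factor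
    \<i> turns the real part of x - b into an imaginary part: at x = -v both c' and c' + x have
    imaginary part Im c - Re b - v, which is negative for large v.\<close>
  define c' where "c' x = c + \<i> * (x - b)" for x
  define M where "M = partial_sum m r"
  define D where "D = {x. pochhammer (x + 1 / 2) M \<noteq> 0 \<and> pochhammer (c' x + 1 / 2) M \<noteq> 0 \<and>
     pochhammer (1 / 2 + c' x + x + of_nat M) k \<noteq> 0 \<and> pochhammer (2 * c' x + 2 * x) k \<noteq> 0 \<and>
     R_defined x (c' x) r f m (of_nat k)}"
  define L where "L x = (\<Sum>j=0..k. fps_nth (lhs_series x (c' x) r f m) j * fps_nth (lhs_series x (c' x) r f m) (k - j))" for x
  define R where "R x = rhs_prefactor x (c' x) M * fps_nth (rhs_series x (c' x) r f m) k" for x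
  have f_nz: "pochhammer (f t) n \<noteq> 0" if "t \<in> {1..r}" for t n
    using f[OF that] by (auto simp: pochhammer_eq_0_iff)
  have c': "ratfun_on D c'"
    unfolding c'_def by (intro ratfun_on_intros)
  have DD: "pochhammer (x + 1 / 2) M \<noteq> 0" "pochhammer (c' x + 1 / 2) M \<noteq> 0"
     "pochhammer (1 / 2 + c' x + x + of_nat M) k \<noteq> 0" "pochhammer (2 * c' x + 2 * x) k \<noteq> 0"
     "R_defined x (c' x) r f m (of_nat k)" if "x \<in> D" for x
    using that by (simp_all add: D_def)
  have DD': "pochhammer (1 / 2 + c' x + x + of_nat M) j \<noteq> 0" if "x \<in> D" "j \<le> k" for x j
    by (rule pochhammer_neq_0_mono[OF DD(3)[OF that(1)] that(2)])
  have "ratfun_on D L"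
    unfolding L_def lhs_series_nth M_def[symmetric]
    by (intro ratfun_on_divide ratfun_on_intros c') (auto simp: f_nz DD')
  moreover have "ratfun_on D R"
    unfolding R_def rhs_prefactor_def rhs_series_def fps_nth_Abs_fps M_def[symmetric]
    by (intro ratfun_on_divide ratfun_on_R_fun ratfun_on_intros c') (auto simp: DD)
  moreover define A where "A = (\<lambda>v. - of_nat v :: complex) ` {v. k \<le> v \<and> Im c - Re b < real v}"
  have "infinite A"
  proof -
    have "{max k (nat \<lceil>Im c - Re b\<rceil> + 1)..} \<subseteq> {v. k \<le> v \<and> Im c - Re b < real v}"
      by (auto simp: nat_le_iff ceiling_le_iff Suc_le_eq) linarith
    then have "infinite {v. k \<le> v \<and> Im c - Re b < real v}"
      using infinite_Ici infinite_super by blast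
    then show ?thesis
      unfolding A_def by (subst finite_image_iff) (auto simp: inj_on_def)
  qed
  moreover have A: "x \<in> D \<and> L x = R x" if "x \<in> A" for x
  proof -
    obtain v where v: "x = - of_nat v" "k \<le> v" "Im c - Re b < real v"
      using \<open>x \<in> A\<close> by (auto simp: A_def)
    have Im: "Im (c' x) \<noteq> 0" "Im x = 0"
      using v(3) by (simp_all add: c'_def v(1))
    have Rd: "R_defined x (c' x) r f m (of_nat k)"
      by (rule R_defined_change_bc[of b c]) (use dfd Im in \<open>auto simp: both_sides_defined_def\<close>)
    have "pochhammer (x + 1 / 2) M \<noteq> 0"
      by (rule pochhammer_nonzero_if_notin_Ints) (use half_notin_Ints in \<open>auto simp: v(1)\<close>)
    then have "x \<in> D"
      using Rd Im by (auto simp: D_def intro!: pochhammer_nonzero_if_notin_Ints Im_nonzero_notin_Ints)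
    moreover have "L x = R x"
      using Rd Im v f unfolding L_def R_def M_def v(1)
      by (intro lhs_series_square_nth_nonpos_int[OF r _ v(2)]) auto
    ultimately show ?thesis by blast
  qed
  moreover have "b \<in> D"
    using dfd by (auto simp: D_def c'_def both_sides_defined_def M_def)
  ultimately have "L b = R b"
    by (intro ratfun_on_identity[of D L R A b]) auto
  then show ?thesis
    by (simp add: L_def R_def c'_def M_def)
qed

theorem theorem1:
  fixes r :: nat and m :: "nat \<Rightarrow> nat" and f :: "nat \<Rightarrow> complex" and b c :: complex
  assumes "r \<ge> 1"
    and "\<And>j. j \<in> {1..r} \<Longrightarrow> m j > 0"
    and "\<And>j. j \<in> {1..r} \<Longrightarrow> f j \<notin> \<int>\<^sub>\<le>\<^sub>0"
    and "both_sides_defined b c r f m"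
  shows "(lhs_series b c r f m)\<^sup>2 =
           fps_const (rhs_prefactor b c (partial_sum m r)) * rhs_series b c r f m \<and>
         (\<exists>p q. q \<noteq> 0 \<and> (\<forall>k. R_defined b c r f m k \<longrightarrow>
            poly q k \<noteq> 0 \<and> R_fun b c r f m k = poly p k / poly q k))"
proof
  show "(lhs_series b c r f m)\<^sup>2 =
           fps_const (rhs_prefactor b c (partial_sum m r)) * rhs_series b c r f m"
    by (rule fps_ext)
      (simp only: power2_eq_square fps_mult_nth[of "lhs_series b c r f m"] fps_mult_left_const_nth
        lhs_series_square_nth[OF assms(1,3,4)])
  have "ratfun_on {k. R_defined b c r f m k} (\<lambda>k. R_fun b c r f m k)"
    by (intro ratfun_on_R_fun ratfun_on_const ratfun_on_ident) simp
  then obtain p q where "\<forall>k. R_defined b c r f m k \<longrightarrow> poly q k \<noteq> 0 \<and> R_fun b c r f m k = poly p k / poly q k"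
    unfolding ratfun_on_def by auto
  \<comment> \<open>A point where R is defined is a point where q does not vanish, which excludes
    the zero polynomial.\<close>
  moreover have "R_defined b c r f m (of_nat 0)"
    using assms(4) unfolding both_sides_defined_def by blast
  ultimately show "\<exists>p q. q \<noteq> 0 \<and> (\<forall>k. R_defined b c r f m k \<longrightarrow>
            poly q k \<noteq> 0 \<and> R_fun b c r f m k = poly p k / poly q k)"
    by (metis poly_0)
qed

end
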